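(* Let $0<\alpha<1$ and $B>0$, and let $(X_n)_{n\ge0}$ be the nearest neighbour walk on $\{0,1,2,\dots\}$ with $p_R=\frac{B}{4R^{\alpha}}$ (in the sense described in the context). Put $$f^*(R,\varepsilon)=\frac{(1+\varepsilon)(1-\alpha)\log R}{\log 2},\qquad g^*(R)=f^*(R,0)=\frac{(1-\alpha)\log R}{\log 2}.$$ Then: (1) With probability $1$ there exist infinitely many $R$ for which $\xi(R+j,\infty)=1$ for each integer $j$ with $0\le j\le g^*(R)$. (2) With probability $1$, for any $\varepsilon>0$ and each $R$ large enough there exists an integer $S$ with $$R\le S\le R+f^*(R,\varepsilon)$$ such that $\xi(S,\infty)>1$.
   Context: Walk: for $0\le p_i<1/2$, $i\ge1$, $(X_n)_{n\ge0}$ is the Markov chain on $\{0,1,2,\dots\}$ with $X_0=0$ and $\mathbf P(X_{n+1}=i+1\mid X_n=i)=1-\mathbf P(X_{n+1}=i-1\mid X_n=i)=E_i$, where $E_0=1$ and $E_i=1/2+p_i$ for $i\ge1$. Convention: "$p_i=\frac{B}{4i^{\alpha}}$" means: let $i_0=\min\{i\ge1:\frac{B}{4i^{\alpha}}<\frac12\}$; then $p_i=\frac{B}{4i^{\alpha}}$ for $i\ge i_0$ and $p_i=p_{i_0}$ for $1\le i\le i_0$. Local time: $\xi(x,\infty)=\#\{k\ge0:X_k=x\}$. *)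

theory Defs
  imports "HOL-Probability.Probability" "HOL-Library.Extended_Nat"
begin

text \<open>Both conditional probabilities are only constrained when the conditioning event has
  positive probability (otherwise \<^const>\<open>cond_prob\<close> is the junk value 0).\<close>

definition markov_property :: "'a measure \<Rightarrow> (nat \<Rightarrow> 'a \<Rightarrow> nat) \<Rightarrow> bool" where
  "markov_property M X \<longleftrightarrow>
     (\<forall>n x j. \<P>(\<omega> in M. \<forall>k\<le>n. X k \<omega> = x k) > 0 \<longrightarrow>
        \<P>(\<omega> in M. X (Suc n) \<omega> = j \<bar> \<forall>k\<le>n. X k \<omega> = x k) =
        \<P>(\<omega> in M. X (Suc n) \<omega> = j \<bar> X n \<omega> = x n))"

definition up_prob :: "(nat \<Rightarrow> real) \<Rightarrow> nat \<Rightarrow> real" where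
  "up_prob p i = (if i = 0 then 1 else 1/2 + p i)"

text \<open>The event of a step from i to i - 1 is written with the successor function on the left,
  so that for i = 0 it is the impossible event rather than a step from 0 to 0.\<close>

definition nn_walk :: "'a measure \<Rightarrow> (nat \<Rightarrow> 'a \<Rightarrow> nat) \<Rightarrow> (nat \<Rightarrow> real) \<Rightarrow> bool" where
  "nn_walk M X p \<longleftrightarrow>
     prob_space M \<and>
     (\<forall>n. X n \<in> measurable M (count_space UNIV)) \<and>
     (AE \<omega> in M. X 0 \<omega> = 0) \<and>
     markov_property M X \<and>
     (\<forall>n i. \<P>(\<omega> in M. X n \<omega> = i) > 0 \<longrightarrow>
        \<P>(\<omega> in M. X (Suc n) \<omega> = Suc i \<bar> X n \<omega> = i) = up_prob p i \<and>
        \<P>(\<omega> in M. Suc (X (Suc n) \<omega>) = i \<bar> X n \<omega> = i) = 1 - up_prob p i)"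

definition drift_cutoff :: "real \<Rightarrow> real \<Rightarrow> nat" where
  "drift_cutoff B \<alpha> = (LEAST i::nat. 1 \<le> i \<and> B / (4 * real i powr \<alpha>) < 1/2)"

text \<open>Only the values at positive arguments matter: \<^const>\<open>up_prob\<close> ignores the value at 0.\<close>

definition power_drift :: "real \<Rightarrow> real \<Rightarrow> nat \<Rightarrow> real" where
  "power_drift B \<alpha> i =
     (if drift_cutoff B \<alpha> \<le> i then B / (4 * real i powr \<alpha>)
      else B / (4 * real (drift_cutoff B \<alpha>) powr \<alpha>))"

definition local_time :: "(nat \<Rightarrow> 'a \<Rightarrow> nat) \<Rightarrow> 'a \<Rightarrow> nat \<Rightarrow> enat" where
  "local_time X \<omega> x =
     (if finite {k. X k \<omega> = x} then enat (card {k. X k \<omega> = x}) else \<infinity>)"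

definition f_star :: "real \<Rightarrow> nat \<Rightarrow> real \<Rightarrow> real" where
  "f_star \<alpha> R \<epsilon> = (1 + \<epsilon>) * (1 - \<alpha>) * ln (real R) / ln 2"

definition g_star :: "real \<Rightarrow> nat \<Rightarrow> real" where
  "g_star \<alpha> R = f_star \<alpha> R 0"

end

theory Submission
  imports Defs "HOL-Real_Asymp.Real_Asymp"
begin

text \<open>
  The set \<open>{R, ..., R + L}\<close> consists of points visited exactly once iff, from its first visit to
  \<open>R\<close>, the walk makes \<open>L + 1\<close> upward steps and never comes back to \<open>R + L\<close>. The scale function of
  the walk, with increments \<open>d\<close> and tails \<open>H\<close>, turns the probability of this event into
  \<open>(\<Prod>j\<le>L. E (R + j)) * d (R + L) / H (R + L)\<close>, where the escape probability \<open>d R / H R\<close> is of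
  order \<open>R powr - \<alpha>\<close> and the product of order \<open>2 powr - L\<close>. For \<open>L \<approx> f_star \<alpha> R \<epsilon>\<close> this is of
  order \<open>R powr (- 1 - \<epsilon> * (1 - \<alpha>))\<close>. If \<open>\<epsilon> > 0\<close>, this is summable and Borel--Cantelli gives (2).
  If \<open>\<epsilon> = 0\<close>, the series diverges like the harmonic series; the events at \<open>R < S\<close> decouple up to
  the factor \<open>H Q / (H Q - H S)\<close> with \<open>Q = R + L\<close>, so that the covariances sum up to at most a
  constant times the expected number of events, and Chebyshev's inequality gives (1).
\<close>

section \<open>The law of the walk on path space\<close>

lemma all_nat_split: "(\<forall>k. P k) \<longleftrightarrow> P 0 \<and> (\<forall>k. P (Suc k))" for P :: "nat \<Rightarrow> bool"
  by (metis not0_implies_Suc)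

text \<open>A step down is written with the successor on the left: truncated subtraction would also
  admit a step from 0 to 0.\<close>

definition nn_path :: "nat stream \<Rightarrow> bool" where
  "nn_path s \<longleftrightarrow> (\<forall>k. s !! Suc k = Suc (s !! k) \<or> Suc (s !! Suc k) = s !! k)"

lemma measurable_nn_path [measurable]: "Measurable.pred (stream_space (count_space UNIV)) nn_path"
proof -
  \<comment> \<open>The comparison of two coordinates is reduced to conditions on single coordinates
    by quantifying over the countably many values \<open>i\<close>.\<close>
  have "nn_path = (\<lambda>s. \<forall>k i. s !! k = i \<longrightarrow> s !! Suc k = Suc i \<or> s !! Suc k \<in> {j. Suc j = i})"
    by (auto simp: nn_path_def fun_eq_iff)
  then show ?thesis by (rule ssubst) measurable
qed

lemma pred_stream_sets: "Measurable.pred (stream_space (count_space UNIV)) P \<Longrightarrow>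
    {s. P s} \<in> sets (stream_space (count_space (UNIV :: nat set)))"
  by (drule predE) (simp add: space_stream_space)

text \<open>An independent sequence of such uniform variables, one for each step, drives the walk,
  so that paths become measurable functions on \<open>stream_space coin\<close>.\<close>

definition coin :: "real measure" where
  "coin = uniform_measure lborel {0..1}"

lemma prob_space_coin: "prob_space coin"
  unfolding coin_def by (rule prob_space_uniform_measure) auto

lemma sets_coin [simp, measurable_cong]: "sets coin = sets borel"
  by (simp add: coin_def)

lemma space_coin [simp]: "space coin = UNIV"
  by (simp add: coin_def)

lemma emeasure_coin:
  assumes "0 \<le> e" "e \<le> 1"
  shows "emeasure coin {..<e} = ennreal e" "emeasure coin {e..} = ennreal (1 - e)"
proof -
  have "{0..1} \<inter> {..<e} = {0..<e}" "{0..1} \<inter> {e..} = {e..1}" using assms by auto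
  then show "emeasure coin {..<e} = ennreal e" "emeasure coin {e..} = ennreal (1 - e)"
    using assms by (simp_all add: coin_def divide_ennreal_def)
qed

locale walk =
  fixes E :: "nat \<Rightarrow> real"
  assumes E_0: "E 0 = 1" and E_pos: "0 < E i" and E_less_1: "0 < i \<Longrightarrow> E i < 1"
begin

lemma E_le_1: "E i \<le> 1"
  using E_0 E_less_1[of i] by (cases "i = 0") auto

text \<open>The clause \<open>x = 0\<close> is not subsumed by \<open>t < E x\<close>: a value
  \<open>t\<close> of 1 or more would otherwise leave the walk at 0. With it, every trajectory moves
  by unit steps, not just almost every one.\<close>

definition move :: "nat \<Rightarrow> real \<Rightarrow> nat" where
  "move x t = (if x = 0 \<or> t < E x then Suc x else x - 1)"

primrec position :: "nat \<Rightarrow> real stream \<Rightarrow> nat \<Rightarrow> nat" where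
  "position x s 0 = x"
| "position x s (Suc n) = position (move x (shd s)) (stl s) n"

definition trajectory :: "nat \<Rightarrow> real stream \<Rightarrow> nat stream" where
  "trajectory x s = to_stream (position x s)"

lemma trajectory_Stream: "trajectory x (t ## s) = x ## trajectory (move x t) s"
  unfolding trajectory_def
  by (subst to_stream_nat_case[symmetric]) (auto simp: fun_eq_iff split: nat.split intro!: arg_cong[of _ _ to_stream])

lemma position_nn: "position x s (Suc k) = Suc (position x s k) \<or> Suc (position x s (Suc k)) = position x s k"
  by (induction k arbitrary: x s) (auto simp: move_def)

lemma nn_path_trajectory: "nn_path (trajectory x s)"
  unfolding nn_path_def trajectory_def to_stream_def using position_nn
  by (simp del: position.simps)

lemma shd_trajectory: "shd (trajectory x s) = x"
  by (simp add: trajectory_def to_stream_def)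

lemma measurable_move [measurable]: "move x \<in> borel \<rightarrow>\<^sub>M count_space UNIV"
  unfolding move_def by measurable

lemma measurable_position [measurable]:
  "(\<lambda>s. position x s n) \<in> stream_space borel \<rightarrow>\<^sub>M count_space UNIV"
proof (induction n arbitrary: x)
  case (Suc n)
  note Suc[measurable]
  show ?case unfolding position.simps
    by (rule measurable_compose_countable[where f="\<lambda>i s. position i (stl s) n" and g="\<lambda>s. move x (shd s)"])
       measurable
qed simp

lemma measurable_trajectory [measurable]:
  "trajectory x \<in> stream_space borel \<rightarrow>\<^sub>M stream_space (count_space UNIV)"
  by (rule measurable_stream_space2) (simp add: trajectory_def to_stream_def)

text \<open>The law of the walk started at \<open>x\<close>, realised on path space.\<close>

definition K :: "nat \<Rightarrow> nat stream measure" where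
  "K x = distr (stream_space coin) (stream_space (count_space UNIV)) (trajectory x)"

lemma sets_coin_stream [simp, measurable_cong]: "sets (stream_space coin) = sets (stream_space borel)"
  by (rule sets_stream_space_cong) simp

lemma measurable_trajectory_coin [measurable]:
  "trajectory x \<in> stream_space coin \<rightarrow>\<^sub>M stream_space (count_space UNIV)"
  using measurable_trajectory by (simp cong: measurable_cong_sets)

lemma sets_K [simp, measurable_cong]: "sets (K x) = sets (stream_space (count_space UNIV))"
  by (simp add: K_def)

lemma space_K [simp]: "space (K x) = UNIV"
  by (simp add: K_def space_stream_space)

lemma prob_space_K: "prob_space (K x)"
  unfolding K_def
  by (intro prob_space.prob_space_distr prob_space.prob_space_stream_space prob_space_coin) simp

sublocale K: prob_space "K x" for x
  by (rule prob_space_K)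

lemma AE_K_nn: "AE s in K x. shd s = x \<and> nn_path s"
  unfolding K_def
  by (subst AE_distr_iff) (simp_all add: shd_trajectory nn_path_trajectory)

abbreviation pr :: "nat \<Rightarrow> (nat stream \<Rightarrow> bool) \<Rightarrow> real" where
  "pr x P \<equiv> measure (K x) {s. P s}"

lemma pr_eq_AE:
  assumes "\<And>s. shd s = x \<Longrightarrow> nn_path s \<Longrightarrow> P s \<longleftrightarrow> Q s"
    and [measurable]: "Measurable.pred (stream_space (count_space UNIV)) P"
      "Measurable.pred (stream_space (count_space UNIV)) Q"
  shows "pr x P = pr x Q"
proof (rule measure_eq_AE)
  show "AE s in K x. s \<in> {s. P s} \<longleftrightarrow> s \<in> {s. Q s}"
    using AE_K_nn[of x] by eventually_elim (simp add: assms(1))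
qed (simp_all add: pred_stream_sets)

lemma pr_mono_AE:
  assumes "\<And>s. shd s = x \<Longrightarrow> nn_path s \<Longrightarrow> P s \<Longrightarrow> Q s"
    and [measurable]: "Measurable.pred (stream_space (count_space UNIV)) Q"
  shows "pr x P \<le> pr x Q"
proof (rule K.finite_measure_mono_AE)
  show "AE s in K x. s \<in> {s. P s} \<longrightarrow> s \<in> {s. Q s}"
    using AE_K_nn[of x] by eventually_elim (simp add: assms(1))
qed (simp_all add: pred_stream_sets)

text \<open>First-step analysis: the first uniform variable is independent of the later ones and
  decides the first move. For \<open>x = 0\<close> the second term has weight
  \<open>1 - E 0 = 0\<close>, so the truncated \<open>x - 1\<close> does no harm.\<close>

lemma pr_step:
  assumes P[measurable]: "Measurable.pred (stream_space (count_space UNIV)) P"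
  shows "pr x P = E x * pr (Suc x) (\<lambda>s. P (x ## s)) + (1 - E x) * pr (x - 1) (\<lambda>s. P (x ## s))"
proof -
  interpret C: prob_space coin by (rule prob_space_coin)
  interpret S: prob_space "stream_space coin" by (rule C.prob_space_stream_space)
  let ?u = "pr (Suc x) (\<lambda>s. P (x ## s))" and ?v = "pr (x - 1) (\<lambda>s. P (x ## s))"
  have sp: "space (stream_space coin) = UNIV" by (simp add: space_stream_space)
  have *: "\<P>(s in stream_space coin. Q (trajectory y s)) = pr y Q"
    if [measurable]: "Measurable.pred (stream_space (count_space UNIV)) Q" for y Q
    unfolding K_def by (subst measure_distr) (auto simp: sp vimage_def space_stream_space pred_stream_sets)
  have **: "\<P>(s in stream_space coin. P (x ## trajectory y s)) = pr y (\<lambda>s. P (x ## s))" for y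
    by (rule *) measurable
  have "ennreal (pr x P) = \<P>(s in stream_space coin. P (trajectory x s))"
    by (simp add: *)
  also have "\<dots> = (\<integral>\<^sup>+t. \<P>(s in stream_space coin. P (trajectory x (t ## s))) \<partial>coin)"
    by (rule C.prob_stream_space) measurable
  also have "\<dots> = (\<integral>\<^sup>+t. (if x = 0 \<or> t < E x then ?u else ?v) \<partial>coin)"
    by (intro nn_integral_cong) (simp add: trajectory_Stream move_def **)
  also have "\<dots> = (\<integral>\<^sup>+t. ennreal ?u * indicator {t. x = 0 \<or> t < E x} t + ennreal ?v * indicator {t. \<not> (x = 0 \<or> t < E x)} t \<partial>coin)"
    by (intro nn_integral_cong) (auto split: split_indicator)
  also have "\<dots> = ennreal ?u * emeasure coin {t. x = 0 \<or> t < E x} + ennreal ?v * emeasure coin {t. \<not> (x = 0 \<or> t < E x)}"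
    by (subst nn_integral_add) (auto simp: nn_integral_cmult_indicator)
  also have "\<dots> = ennreal ?u * ennreal (E x) + ennreal ?v * ennreal (1 - E x)"
  proof (cases "x = 0")
    case True
    then show ?thesis using C.emeasure_space_1 by (simp add: E_0)
  next
    case False
    then have "{t. x = 0 \<or> t < E x} = {..<E x}" "{t. \<not> (x = 0 \<or> t < E x)} = {E x..}" by auto
    then show ?thesis using emeasure_coin[of "E x"] E_pos[of x] E_le_1[of x] by simp
  qed
  also have "\<dots> = ennreal (E x * ?u + (1 - E x) * ?v)"
    using E_pos[of x] E_le_1[of x]
    by (simp add: ennreal_plus ennreal_mult less_imp_le mult.commute del: ennreal_plus[symmetric])
  finally show ?thesis
    using E_pos[of x] E_le_1[of x] by (subst (asm) ennreal_inj) auto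
qed


definition trans :: "nat \<Rightarrow> nat \<Rightarrow> real" where
  "trans i j = (if j = Suc i then E i else if Suc j = i then 1 - E i else 0)"

text \<open>Repeated first-step analysis. These cylinder probabilities serve to identify
  \<open>K 0\<close> with the law of the given walk.\<close>

lemma pr_prefix:
  "pr x (\<lambda>s. \<forall>k\<le>n. s !! k = y k) = (if y 0 = x then \<Prod>k<n. trans (y k) (y (Suc k)) else 0)"
proof (induction n arbitrary: x y)
  case 0
  have "pr x (\<lambda>s. \<forall>k\<le>0. s !! k = y k) = pr x (\<lambda>s. y 0 = x)"
    by (rule pr_eq_AE) auto
  then show ?case using K.prob_space[of x] by simp
next
  case (Suc n)
  let ?y = "\<lambda>k. y (Suc k)"
  have "(\<forall>k\<le>Suc n. (x ## s) !! k = y k) \<longleftrightarrow> y 0 = x \<and> (\<forall>k\<le>n. s !! k = ?y k)" for s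
    by (subst all_nat_split) auto
  then have "pr x (\<lambda>s. \<forall>k\<le>Suc n. s !! k = y k) =
      E x * pr (Suc x) (\<lambda>s. y 0 = x \<and> (\<forall>k\<le>n. s !! k = ?y k)) +
      (1 - E x) * pr (x - 1) (\<lambda>s. y 0 = x \<and> (\<forall>k\<le>n. s !! k = ?y k))"
    by (subst pr_step) simp_all
  also have "\<dots> = (if y 0 = x then \<Prod>k<Suc n. trans (y k) (y (Suc k)) else 0)"
  proof (cases "y 0 = x")
    case True
    then have "E x * pr (Suc x) (\<lambda>s. \<forall>k\<le>n. s !! k = ?y k) +
      (1 - E x) * pr (x - 1) (\<lambda>s. \<forall>k\<le>n. s !! k = ?y k) =
      trans x (?y 0) * (\<Prod>k<n. trans (?y k) (?y (Suc k)))"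
      unfolding Suc.IH by (cases x) (auto simp: trans_def E_0)
    then show ?thesis using True
      by (simp add: prod.lessThan_Suc_shift del: prod.lessThan_Suc)
  qed simp
  finally show ?case .
qed

end

section \<open>Identification of the given walk with the canonical one\<close>

lemma nn_walk_prefix:
  assumes walk: "nn_walk M X p" and E: "walk (up_prob p)"
  shows "\<P>(\<omega> in M. \<forall>k\<le>n. X k \<omega> = y k) =
    (if y 0 = 0 then \<Prod>k<n. walk.trans (up_prob p) (y k) (y (Suc k)) else 0)"
proof -
  interpret prob_space M using walk by (simp add: nn_walk_def)
  interpret W: walk "up_prob p" by (rule E)
  have [measurable]: "X n \<in> M \<rightarrow>\<^sub>M count_space UNIV" for n
    using walk by (simp add: nn_walk_def)
  have trans: "\<P>(\<omega> in M. X (Suc n) \<omega> = j \<bar> X n \<omega> = i) = W.trans i j"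
    if pos: "\<P>(\<omega> in M. X n \<omega> = i) > 0" for n i j
  proof -
    have up: "\<P>(\<omega> in M. X (Suc n) \<omega> = Suc i \<bar> X n \<omega> = i) = up_prob p i"
      and down: "\<P>(\<omega> in M. Suc (X (Suc n) \<omega>) = i \<bar> X n \<omega> = i) = 1 - up_prob p i"
      using walk pos unfolding nn_walk_def by blast+
    consider "j = Suc i" | "Suc j = i" | "j \<noteq> Suc i" "Suc j \<noteq> i" by blast
    then show ?thesis
    proof cases
      case 1
      then show ?thesis using up by (simp add: W.trans_def)
    next
      case 2
      then have "(Suc (X (Suc n) \<omega>) = i) = (X (Suc n) \<omega> = j)" for \<omega> by auto
      then show ?thesis using 2 down by (simp add: W.trans_def)
    next
      \<comment> \<open>The conditional probabilities of the steps up and down already add up to 1,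
        so no mass is left for any other \<open>j\<close>.\<close>
      case 3
      let ?N = "\<P>(\<omega> in M. X n \<omega> = i)"
      let ?A = "{\<omega> \<in> space M. X (Suc n) \<omega> = Suc i \<and> X n \<omega> = i}"
      let ?B = "{\<omega> \<in> space M. Suc (X (Suc n) \<omega>) = i \<and> X n \<omega> = i}"
      let ?C = "{\<omega> \<in> space M. X (Suc n) \<omega> = j \<and> X n \<omega> = i}"
      have [measurable]: "?A \<in> events" "?B \<in> events" "?C \<in> events" by measurable
      have "prob ?A + prob ?B = ?N"
        using up down pos by (simp add: cond_prob_def field_simps)
      moreover have "prob (?A \<union> ?B \<union> ?C) = prob ?A + prob ?B + prob ?C"
        using 3 by (subst finite_measure_Union; (subst finite_measure_Union)?) auto
      moreover have "prob (?A \<union> ?B \<union> ?C) \<le> ?N"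
        by (intro finite_measure_mono) auto
      ultimately have "prob ?C = 0" using measure_nonneg[of M ?C] by linarith
      then show ?thesis using 3 by (simp add: cond_prob_def W.trans_def)
    qed
  qed
  show ?thesis
  proof (induction n)
    case 0
    have "\<P>(\<omega> in M. X 0 \<omega> = y 0) = (if y 0 = 0 then 1 else 0)"
    proof (cases "y 0 = 0")
      case True
      then show ?thesis using walk by (simp add: nn_walk_def prob_Collect_eq_1)
    next
      case False
      have "AE \<omega> in M. X 0 \<omega> \<noteq> y 0"
        using walk False by (auto simp: nn_walk_def elim: eventually_mono)
      then show ?thesis using False by (simp add: prob_Collect_eq_0)
    qed
    then show ?case by simp
  next
    case (Suc n)
    let ?P = "\<P>(\<omega> in M. \<forall>k\<le>n. X k \<omega> = y k)"
    have eq: "(\<forall>k\<le>Suc n. X k \<omega> = y k) \<longleftrightarrow> X (Suc n) \<omega> = y (Suc n) \<and> (\<forall>k\<le>n. X k \<omega> = y k)" for \<omega>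
      by (auto simp: le_Suc_eq)
    have "\<P>(\<omega> in M. \<forall>k\<le>Suc n. X k \<omega> = y k) = ?P * W.trans (y n) (y (Suc n))"
    proof (cases "?P > 0")
      case True
      have "?P \<le> \<P>(\<omega> in M. X n \<omega> = y n)"
        by (intro finite_measure_mono) auto
      then have "\<P>(\<omega> in M. X (Suc n) \<omega> = y (Suc n) \<bar> X n \<omega> = y n) = W.trans (y n) (y (Suc n))"
        using True by (intro trans) linarith
      moreover have "markov_property M X"
        using walk by (simp add: nn_walk_def)
      ultimately have "\<P>(\<omega> in M. X (Suc n) \<omega> = y (Suc n) \<bar> \<forall>k\<le>n. X k \<omega> = y k) = W.trans (y n) (y (Suc n))"
        using True unfolding markov_property_def by simp
      then show ?thesis using True unfolding eq by (simp add: cond_prob_def field_simps)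
    next
      \<comment> \<open>Conditioning on a null event gives no information, but then the longer
        prefix is null as well and both sides vanish.\<close>
      case False
      then have "?P = 0" using measure_nonneg[of M "{\<omega> \<in> space M. \<forall>k\<le>n. X k \<omega> = y k}"] by linarith
      moreover have "\<P>(\<omega> in M. \<forall>k\<le>Suc n. X k \<omega> = y k) \<le> ?P"
        by (intro finite_measure_mono) auto
      ultimately show ?thesis
        using measure_nonneg[of M "{\<omega> \<in> space M. \<forall>k\<le>Suc n. X k \<omega> = y k}"] by simp
    qed
    then show ?case using Suc.IH by simp
  qed
qed

text \<open>The two laws agree on the cylinder sets \<open>sstart UNIV xs\<close>, and these
  determine a probability measure on streams over a countable set. Almost sure statements can
  therefore be proved under \<open>K 0\<close>.\<close>

lemma nn_walk_distr:
  assumes walk: "nn_walk M X p" and E: "walk (up_prob p)"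
  shows "(\<lambda>\<omega>. to_stream (\<lambda>n. X n \<omega>)) \<in> M \<rightarrow>\<^sub>M stream_space (count_space UNIV)" (is ?meas)
    and "distr M (stream_space (count_space UNIV)) (\<lambda>\<omega>. to_stream (\<lambda>n. X n \<omega>)) = walk.K (up_prob p) 0"
      (is "?D = _")
proof -
  interpret prob_space M using walk by (simp add: nn_walk_def)
  interpret W: walk "up_prob p" by (rule E)
  have [measurable]: "X n \<in> M \<rightarrow>\<^sub>M count_space UNIV" for n
    using walk by (simp add: nn_walk_def)
  show meas [measurable]: ?meas
    by (rule measurable_stream_space2) (simp add: to_stream_def)
  interpret D: prob_space ?D by (rule prob_space_distr) measurable
  show "?D = W.K 0"
  proof (rule stream_space_eq_sstart[where S=UNIV])
    show "prob_space ?D" by (rule D.prob_space_axioms)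
    fix xs :: "nat list" assume "xs \<noteq> []"
    then obtain n where n: "length xs = Suc n" by (cases xs) auto
    have sstart: "sstart UNIV xs = {s. \<forall>k\<le>n. s !! k = xs ! k}"
      using n sstart_eq[of _ UNIV xs] by (auto simp: less_Suc_eq_le)
    have "measure ?D (sstart UNIV xs) = \<P>(\<omega> in M. \<forall>k\<le>n. X k \<omega> = xs ! k)"
      by (subst measure_distr[OF meas])
         (auto simp: sstart to_stream_def intro!: arg_cong[of _ _ prob] pred_stream_sets)
    also have "\<dots> = measure (W.K 0) (sstart UNIV xs)"
      unfolding sstart nn_walk_prefix[OF walk E] W.pr_prefix ..
    finally show "emeasure ?D (sstart UNIV xs) = emeasure (W.K 0) (sstart UNIV xs)"
      by (simp only: W.K.emeasure_eq_measure D.emeasure_eq_measure)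
  qed (simp_all add: W.prob_space_K)
qed

section \<open>Hitting probabilities\<close>

text \<open>The passage time stays implicit: \<open>G\<close> is imposed on the path from the first
  visit to \<open>R\<close> onwards, and that visit has to occur. In this form an event unfolds
  letter by letter, which suits first-step analysis.\<close>

definition first_passage :: "nat \<Rightarrow> (nat stream \<Rightarrow> bool) \<Rightarrow> nat stream \<Rightarrow> bool" where
  "first_passage R G = (\<lambda>s. shd s \<noteq> R) suntil (\<lambda>s. shd s = R \<and> G s)"

definition reach_before :: "nat \<Rightarrow> nat \<Rightarrow> (nat stream \<Rightarrow> bool) \<Rightarrow> nat stream \<Rightarrow> bool" where
  "reach_before Q S G = (\<lambda>s. shd s \<noteq> Q \<and> shd s \<noteq> S) suntil (\<lambda>s. shd s = S \<and> G s)"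

primrec ascend :: "nat \<Rightarrow> (nat stream \<Rightarrow> bool) \<Rightarrow> nat stream \<Rightarrow> bool" where
  "ascend 0 G s = G s"
| "ascend (Suc n) G s = (shd (stl s) = Suc (shd s) \<and> ascend n G (stl s))"

definition avoid :: "nat \<Rightarrow> nat stream \<Rightarrow> bool" where
  "avoid Q s \<longleftrightarrow> (\<forall>k. s !! k \<noteq> Q)"

text \<open>After \<open>Suc L\<close> steps up the path is at \<open>R + L + 1\<close>, so
  \<open>avoid\<close> forbids only returns to \<open>R + L\<close>. By unit steps, a return to any
  lower point of the run would have to pass through \<open>R + L\<close>.\<close>

definition straight_cut :: "nat \<Rightarrow> nat \<Rightarrow> nat stream \<Rightarrow> bool" where
  "straight_cut R L = ascend (Suc L) (avoid (R + L))"

lemma measurable_first_passage [measurable]: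
  assumes [measurable]: "Measurable.pred (stream_space (count_space UNIV)) G"
  shows "Measurable.pred (stream_space (count_space UNIV)) (first_passage R G)"
  unfolding first_passage_def by measurable

lemma measurable_reach_before [measurable]:
  assumes [measurable]: "Measurable.pred (stream_space (count_space UNIV)) G"
  shows "Measurable.pred (stream_space (count_space UNIV)) (reach_before Q S G)"
  unfolding reach_before_def by measurable

lemma measurable_ascend [measurable]:
  assumes G: "Measurable.pred (stream_space (count_space UNIV)) G"
  shows "Measurable.pred (stream_space (count_space UNIV)) (ascend n G)"
proof (induction n)
  case 0
  then show ?case using G by simp
next
  case (Suc n)
  note Suc[measurable]
  have "ascend (Suc n) G = (\<lambda>s. \<forall>i. shd s = i \<longrightarrow> shd (stl s) = Suc i \<and> ascend n G (stl s))"
    by auto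
  then show ?case by (rule ssubst) measurable
qed

lemma measurable_avoid [measurable]: "Measurable.pred (stream_space (count_space UNIV)) (avoid Q)"
  unfolding avoid_def by measurable

lemma measurable_straight_cut [measurable]:
  "Measurable.pred (stream_space (count_space UNIV)) (straight_cut R L)"
  unfolding straight_cut_def by measurable

lemma first_passage_Stream:
  "first_passage R G (x ## s) \<longleftrightarrow> (if x = R then G (x ## s) else first_passage R G s)"
  unfolding first_passage_def by (auto simp: suntil_Stream)

lemma reach_before_Stream:
  "reach_before Q S G (x ## s) \<longleftrightarrow> (if x = S then G (x ## s) else x \<noteq> Q \<and> reach_before Q S G s)"
  unfolding reach_before_def by (auto simp: suntil_Stream)

lemma avoid_Stream: "avoid Q (x ## s) \<longleftrightarrow> x \<noteq> Q \<and> avoid Q s"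
  unfolding avoid_def by (subst all_nat_split) simp

context walk
begin

text \<open>As a function of the starting point, the probability of an event that is decided after a
  first passage solves the difference equation of the walk with known boundary values. This replaces
  the strong Markov property throughout.\<close>

lemma pr_first_passage:
  assumes "x \<le> R" and [measurable]: "Measurable.pred (stream_space (count_space UNIV)) G"
  shows "pr x (first_passage R G) = pr R G"
proof -
  let ?u = "\<lambda>x. pr x (first_passage R G)"
  have base: "?u R = pr R G"
    by (subst (1 2) pr_step) (simp_all add: first_passage_Stream)
  have harmonic: "?u x = E x * ?u (Suc x) + (1 - E x) * ?u (x - 1)" if "x \<noteq> R" for x
    using that by (subst (1) pr_step) (simp_all add: first_passage_Stream)
  \<comment> \<open>Since \<open>E 0 = 1\<close>, the values at 0 and 1 agree, and harmonicity at
    each further point below \<open>R\<close> passes the equality on.\<close>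
  have const: "x < R \<Longrightarrow> ?u x = ?u (Suc x)" for x
  proof (induction x)
    case 0
    then show ?case using harmonic[of 0] by (simp add: E_0)
  next
    case (Suc x)
    then have "?u (Suc x) = E (Suc x) * ?u (Suc (Suc x)) + (1 - E (Suc x)) * ?u (Suc x)"
      using harmonic[of "Suc x"] by simp
    then have "E (Suc x) * (?u (Suc x) - ?u (Suc (Suc x))) = 0" by (simp add: algebra_simps)
    then show ?case using E_pos[of "Suc x"] by simp
  qed
  show ?thesis using \<open>x \<le> R\<close> base
    by (induction rule: inc_induct) (simp_all add: const)
qed

lemma pr_ascend:
  assumes [measurable]: "Measurable.pred (stream_space (count_space UNIV)) G"
  shows "pr x (ascend n G) = (\<Prod>j<n. E (x + j)) * pr (x + n) G"
proof (induction n arbitrary: x)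
  case (Suc n)
  have "pr x (ascend (Suc n) G) = E x * pr (Suc x) (\<lambda>s. shd s = Suc x \<and> ascend n G s)
     + (1 - E x) * pr (x - 1) (\<lambda>s. shd s = Suc x \<and> ascend n G s)"
    by (subst pr_step) simp_all
  also have "pr (Suc x) (\<lambda>s. shd s = Suc x \<and> ascend n G s) = pr (Suc x) (ascend n G)"
    by (rule pr_eq_AE) simp_all
  also have "pr (x - 1) (\<lambda>s. shd s = Suc x \<and> ascend n G s) = pr (x - 1) (\<lambda>s. False)"
    by (rule pr_eq_AE) ((simp, arith) | simp)+
  finally show ?case
    by (simp add: Suc prod.lessThan_Suc_shift del: prod.lessThan_Suc)
qed (simp add: ascend.simps(1)[abs_def])

section \<open>The scale function and two-sided exit probabilities\<close>

definition d :: "nat \<Rightarrow> real" where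
  "d x = (\<Prod>j=1..x. (1 - E j) / E j)"

text \<open>The scale function, which is harmonic for the walk at every positive point;
  \<open>d\<close> gives its increments.\<close>

definition h :: "nat \<Rightarrow> real" where
  "h x = (\<Sum>k<x. d k)"

lemma d_pos: "0 < d x"
  unfolding d_def using E_pos E_less_1 by (intro prod_pos) auto

lemma d_Suc: "E (Suc x) * d (Suc x) = (1 - E (Suc x)) * d x"
  using E_pos[of "Suc x"] unfolding d_def by (simp add: field_simps)

lemma h_Suc: "h (Suc x) = h x + d x"
  by (simp add: h_def)

lemma h_strict_mono: "x < y \<Longrightarrow> h x < h y"
  by (rule lift_Suc_mono_less[of h]) (auto simp: h_Suc d_pos)

text \<open>The increments of a harmonic function satisfy the recursion \<open>d_Suc\<close> of the
  increments \<open>d\<close>, so they are proportional to \<open>d\<close>; summing them from the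
  zero at \<open>Q\<close> gives a multiple of \<open>h x - h Q\<close>. The factor
  \<open>d Q\<close> is kept on the left to avoid a division.\<close>

lemma harmonic_linear:
  fixes u :: "nat \<Rightarrow> real"
  assumes "u Q = 0"
    and harmonic: "\<And>x. Q < x \<Longrightarrow> x < S \<Longrightarrow> u x = E x * u (Suc x) + (1 - E x) * u (x - 1)"
    and "Q \<le> x" "x \<le> S"
  shows "u x * d Q = u (Suc Q) * (h x - h Q)"
proof -
  have step: "(u (Suc x) - u x) * d Q = u (Suc Q) * d x" if "Q \<le> x" "x < S" for x
    using that
  proof (induction x rule: dec_induct)
    case base
    then show ?case using \<open>u Q = 0\<close> by simp
  next
    case (step x)
    have "E (Suc x) * (u (Suc (Suc x)) - u (Suc x)) = (1 - E (Suc x)) * (u (Suc x) - u x)"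
      using harmonic[of "Suc x"] step by (simp add: algebra_simps)
    then have "E (Suc x) * ((u (Suc (Suc x)) - u (Suc x)) * d Q) = (1 - E (Suc x)) * ((u (Suc x) - u x) * d Q)"
      by (metis mult.assoc)
    also have "\<dots> = E (Suc x) * (u (Suc Q) * d (Suc x))"
      using step d_Suc[of x] by (simp add: ac_simps)
    finally show ?case using E_pos[of "Suc x"] by simp
  qed
  show ?thesis using \<open>Q \<le> x\<close> \<open>x \<le> S\<close>
  proof (induction x rule: dec_induct)
    case base
    then show ?case using \<open>u Q = 0\<close> by simp
  next
    case (step x)
    then show ?case using \<open>\<And>x. Q \<le> x \<Longrightarrow> x < S \<Longrightarrow> (u (Suc x) - u x) * d Q = u (Suc Q) * d x\<close>[of x]
      by (simp add: h_Suc algebra_simps)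
  qed
qed

text \<open>As a function of the starting point the probability vanishes at \<open>Q\<close>, is
  harmonic in between, and has the known value \<open>pr S G\<close> at \<open>S\<close>; evaluating
  \<open>harmonic_linear\<close> at \<open>S\<close> yields its value next to
  \<open>Q\<close>.\<close>

lemma pr_reach_before:
  assumes "Q < S" and [measurable]: "Measurable.pred (stream_space (count_space UNIV)) G"
  shows "pr (Suc Q) (reach_before Q S G) = d Q / (h S - h Q) * pr S G"
proof -
  let ?u = "\<lambda>x. pr x (reach_before Q S G)"
  have S: "?u S = pr S G"
    by (subst (1 2) pr_step) (simp_all add: reach_before_Stream)
  have Q: "?u Q = 0"
    using \<open>Q < S\<close> by (subst pr_step) (simp_all add: reach_before_Stream)
  have harmonic: "?u x = E x * ?u (Suc x) + (1 - E x) * ?u (x - 1)" if "Q < x" "x < S" for x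
    using that by (subst (1) pr_step) (simp_all add: reach_before_Stream)
  have "?u S * d Q = ?u (Suc Q) * (h S - h Q)"
    using \<open>Q < S\<close> by (intro harmonic_linear[where u="?u" and S=S] Q harmonic) auto
  then show ?thesis
    using h_strict_mono[OF \<open>Q < S\<close>] S by (simp add: field_simps)
qed

end

section \<open>Transience and escape probabilities\<close>

locale transient_walk = walk +
  assumes summable_d: "summable d"
begin

text \<open>The scale left between \<open>x\<close> and infinity. It is positive, decreases to 0,
  and is harmonic at positive points because it differs from \<open>- h x\<close> by a
  constant.\<close>

definition H :: "nat \<Rightarrow> real" where
  "H x = (\<Sum>k. d (k + x))"

lemma summable_d_shift: "summable (\<lambda>k. d (k + x))"
  using summable_d by (simp add: summable_iff_shift)

lemma H_pos: "0 < H x"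
  unfolding H_def using summable_d_shift d_pos by (rule suminf_pos)

lemma H_eq: "H x = suminf d - h x"
  unfolding H_def h_def using suminf_split_initial_segment[OF summable_d, of x] by simp

lemma H_diff: "h y - h x = H x - H y"
  by (simp add: H_eq)

lemma H_Suc: "H (Suc x) = H x - d x"
  by (simp add: H_eq h_Suc)

lemma H_antimono: "x \<le> y \<Longrightarrow> H y \<le> H x"
  by (rule lift_Suc_antimono_le[of H]) (auto simp: H_Suc less_imp_le[OF d_pos])

lemma H_tendsto_0: "H \<longlonglongrightarrow> 0"
proof -
  have "h \<longlonglongrightarrow> suminf d"
    unfolding h_def using summable_LIMSEQ[OF summable_d] .
  then have "(\<lambda>x. suminf d - h x) \<longlonglongrightarrow> suminf d - suminf d"
    by (intro tendsto_intros)
  then show ?thesis by (simp add: H_eq[abs_def])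
qed

text \<open>Maximum principle: \<open>H\<close> is harmonic above \<open>Q\<close>, nonnegative, and
  equal to the bound at \<open>Q\<close>. The finite horizon \<open>n\<close> lets induction on time
  replace optional stopping.\<close>

lemma pr_hit_le:
  assumes "Q \<le> x"
  shows "pr x (\<lambda>s. \<exists>k<n. s !! k = Q) * H Q \<le> H x"
  using assms
proof (induction n arbitrary: x)
  case 0
  then show ?case using H_pos[of x] by simp
next
  case (Suc n)
  show ?case
  proof (cases "x = Q")
    case True
    then show ?thesis using H_pos[of Q] by simp
  next
    case False
    then have x: "Q < x" using Suc.prems by simp
    then obtain y where y: "x = Suc y" by (cases x) auto
    let ?v = "\<lambda>x. pr x (\<lambda>s. \<exists>k<n. s !! k = Q)"
    have eq: "(\<exists>k<Suc n. (x ## s) !! k = Q) \<longleftrightarrow> (\<exists>k<n. s !! k = Q)" for s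
      using x by (auto simp: Ex_less_Suc2)
    have "pr x (\<lambda>s. \<exists>k<Suc n. s !! k = Q) * H Q = E x * (?v (Suc x) * H Q) + (1 - E x) * (?v y * H Q)"
      by (subst pr_step) (simp_all only: eq, simp_all add: y algebra_simps)
    also have "\<dots> \<le> E x * H (Suc x) + (1 - E x) * H y"
      using Suc.IH[of "Suc x"] Suc.IH[of y] x y E_pos[of x] E_le_1[of x]
      by (intro add_mono mult_left_mono) auto
    also have "\<dots> = H x"
      using d_Suc[of y] by (simp add: y H_Suc algebra_simps)
    finally show ?thesis .
  qed
qed

text \<open>The harmonic function \<open>x \<mapsto> pr x (avoid Q)\<close> is a multiple of \<open>h x - h Q\<close>; being at most 1 bounds
  the factor from above, and comparing hitting times with the harmonic function \<^const>\<open>H\<close> bounds it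
  from below.\<close>

lemma pr_avoid: "pr (Suc Q) (avoid Q) = d Q / H Q"
proof (rule antisym)
  let ?u = "\<lambda>x. pr x (avoid Q)"
  have Q: "?u Q = 0"
    by (subst pr_step) (simp_all add: avoid_Stream)
  have harmonic: "?u x = E x * ?u (Suc x) + (1 - E x) * ?u (x - 1)" if "Q < x" for x
    using that by (subst (1) pr_step) (simp_all add: avoid_Stream)
  have "?u (Suc Q) * (H Q - H x) \<le> d Q" if "Q \<le> x" for x
  proof -
    have "?u x * d Q = ?u (Suc Q) * (h x - h Q)"
      using that by (intro harmonic_linear[where u="?u" and S=x] Q harmonic) auto
    moreover have "?u x * d Q \<le> 1 * d Q"
      using d_pos[of Q] by (intro mult_right_mono) auto
    ultimately show ?thesis by (simp add: H_diff)
  qed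
  then have "eventually (\<lambda>x. ?u (Suc Q) * (H Q - H x) \<le> d Q) sequentially"
    by (auto simp: eventually_sequentially)
  moreover have "(\<lambda>x. ?u (Suc Q) * (H Q - H x)) \<longlonglongrightarrow> ?u (Suc Q) * (H Q - 0)"
    by (intro tendsto_intros H_tendsto_0)
  ultimately have "?u (Suc Q) * (H Q - 0) \<le> d Q"
    by (intro tendsto_upperbound) auto
  then show "?u (Suc Q) \<le> d Q / H Q"
    using H_pos[of Q] by (simp add: field_simps)
next
  let ?A = "\<lambda>n. {s. \<exists>k<n. s !! k = Q}"
  have "(\<lambda>n. measure (K (Suc Q)) (?A n)) \<longlonglongrightarrow> measure (K (Suc Q)) (\<Union>n. ?A n)"
    by (intro K.finite_Lim_measure_incseq) (auto simp: incseq_def intro: pred_stream_sets intro: less_le_trans)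
  moreover have "measure (K (Suc Q)) (?A n) \<le> H (Suc Q) / H Q" for n
    using pr_hit_le[of Q "Suc Q" n] H_pos[of Q] by (simp add: field_simps)
  ultimately have "measure (K (Suc Q)) (\<Union>n. ?A n) \<le> H (Suc Q) / H Q"
    by (intro tendsto_upperbound) auto
  moreover have "(\<Union>n. ?A n) = UNIV - {s. avoid Q s}"
    by (auto simp: avoid_def)
  ultimately have "1 - pr (Suc Q) (avoid Q) \<le> H (Suc Q) / H Q"
    using K.prob_compl[of "{s. avoid Q s}" "Suc Q"] by (simp add: pred_stream_sets)
  then show "d Q / H Q \<le> pr (Suc Q) (avoid Q)"
    using H_pos[of Q] by (simp add: H_Suc field_simps)
qed

definition cut_prob :: "nat \<Rightarrow> nat \<Rightarrow> real" where
  "cut_prob R L = (\<Prod>j\<le>L. E (R + j)) * (d (R + L) / H (R + L))"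

lemma pr_straight_cut: "pr R (straight_cut R L) = cut_prob R L"
  unfolding straight_cut_def cut_prob_def
  by (subst pr_ascend) (simp_all add: pr_avoid lessThan_Suc_atMost)

lemma pr_cut: "x \<le> R \<Longrightarrow> pr x (first_passage R (straight_cut R L)) = cut_prob R L"
  by (simp add: pr_first_passage pr_straight_cut)

text \<open>With \<open>G\<close> constantly true, \<open>pr_first_passage\<close> equates the
  probability of ever reaching \<open>S\<close> from 0 with that of the sure event.\<close>

lemma AE_hits: "AE s in K 0. \<forall>S. \<exists>k. s !! k = S"
proof (rule AE_all_countable[THEN iffD2], rule allI)
  fix S
  have "pr 0 (first_passage S (\<lambda>_. True)) = 1"
    using K.prob_space[of S] by (simp add: pr_first_passage)
  then have "AE s in K 0. first_passage S (\<lambda>_. True) s"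
    using K.prob_Collect_eq_1[of 0 "first_passage S (\<lambda>_. True)"] by (simp add: pred_stream_sets)
  then show "AE s in K 0. \<exists>k. s !! k = S"
  proof eventually_elim
    case (elim s)
    then have "ev (\<lambda>s. shd s = S) s"
      unfolding first_passage_def by (drule_tac ev_suntil) simp
    then show ?case by (auto simp: ev_iff_sdrop)
  qed
qed

end

section \<open>Runs of points visited once\<close>

abbreviation clean_cut :: "nat \<Rightarrow> nat \<Rightarrow> nat stream \<Rightarrow> bool" where
  "clean_cut R L \<equiv> first_passage R (straight_cut R L)"

section \<open>Splitting two cuts into successive passages\<close>

lemma nn_path_stl: "nn_path s \<Longrightarrow> nn_path (stl s)"
  unfolding nn_path_def by (metis snth.simps(2))

lemma first_passage_stl: "first_passage S G s \<Longrightarrow> shd s \<noteq> S \<Longrightarrow> first_passage S G (stl s)"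
  by (cases s) (simp add: first_passage_Stream)

lemma first_passage_now: "first_passage S G s \<Longrightarrow> shd s = S \<Longrightarrow> G s"
  by (cases s) (simp add: first_passage_Stream)

text \<open>With unit steps and a start at or below \<open>R\<close>, the path meets no point above
  \<open>R\<close> before reaching \<open>R\<close>. So the first passage to \<open>S\<close> still
  lies ahead at that time and is inherited by the remaining path.\<close>

lemma first_passage_conj:
  assumes "first_passage R G1 s" "nn_path s" "shd s \<le> R" "R < S" "first_passage S G2 s"
  shows "first_passage R (\<lambda>t. G1 t \<and> first_passage S G2 t) s"
  using assms(1-3,5) unfolding first_passage_def[of R]
proof (induction rule: suntil.induct)
  case (base s)
  then show ?case by (intro suntil.base) simp
next
  case (step s)
  have "shd (stl s) = Suc (shd s) \<or> Suc (shd (stl s)) = shd s"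
    using step.prems(1) unfolding nn_path_def by (metis snth.simps)
  then have "shd (stl s) \<le> R" using step by auto
  moreover have "first_passage S G2 (stl s)"
    using step \<open>R < S\<close> by (intro first_passage_stl) auto
  ultimately show ?case
    using step by (intro suntil.step[of _ s]) (auto intro: nn_path_stl)
qed

lemma first_passage_mono:
  assumes "first_passage R G s" "\<And>t. shd t = R \<Longrightarrow> G t \<Longrightarrow> G' t"
  shows "first_passage R G' s"
  using assms(1) unfolding first_passage_def
proof (induction rule: suntil.induct)
  case (base s)
  then show ?case using assms(2) by (intro suntil.base) simp
next
  case (step s)
  then show ?case by (rule_tac suntil.step)
qed

lemma ascend_mono:
  assumes "ascend n G s" "\<And>t. G t \<Longrightarrow> G' t"
  shows "ascend n G' s"
  using assms(1) by (induction n arbitrary: s) (simp_all add: assms(2))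

lemma ascend_conj:
  assumes "ascend n G1 s" "first_passage S G2 s" "shd s + n \<le> S"
  shows "ascend n (\<lambda>t. G1 t \<and> first_passage S G2 t) s"
  using assms
proof (induction n arbitrary: s)
  case (Suc n)
  then show ?case using first_passage_stl[of S G2 s] by simp
qed simp

text \<open>The climb runs through \<open>S\<close>, and this is the first visit there, so
  \<open>G2\<close> holds from that moment on.\<close>

lemma ascend_overlap:
  assumes "ascend n G1 s" "first_passage S G2 s" "shd s \<le> S" "S \<le> shd s + n"
  shows "ascend (S - shd s) G2 s"
  using assms
proof (induction n arbitrary: s)
  case 0
  then have "shd s = S" by simp
  then show ?case using first_passage_now[OF 0(2)] by simp
next
  case (Suc n)
  show ?case
  proof (cases "shd s = S")
    case True
    then show ?thesis using first_passage_now[OF Suc.prems(2)] by simp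
  next
    case False
    have s: "shd (stl s) = Suc (shd s)" "ascend n G1 (stl s)" using Suc.prems(1) by simp_all
    have "ascend (S - shd (stl s)) G2 (stl s)"
      by (rule Suc.IH[OF s(2) first_passage_stl[OF Suc.prems(2) False]])
         (use s(1) False Suc.prems in simp_all)
    moreover have "S - shd s = Suc (S - shd (stl s))" using False Suc.prems(3) s(1) by simp
    ultimately show ?thesis using s(1) by simp
  qed
qed

lemma avoid_reach_before:
  assumes "first_passage S G s" "avoid Q s" "Q \<noteq> S"
  shows "reach_before Q S G s"
  using assms(1,2) unfolding first_passage_def reach_before_def
proof (induction rule: suntil.induct)
  case (base s)
  then show ?case by (intro suntil.base)
next
  case (step s)
  have "shd s \<noteq> Q" "avoid Q (stl s)"
    using step.prems by (cases s, simp add: avoid_Stream)+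
  then show ?case using step by (intro suntil.step[of _ s]) auto
qed

text \<open>Here the climb of the first cut ends at or below \<open>S\<close>. Of the condition to
  avoid \<open>R + L\<close> forever, only the part up to the first passage to \<open>S\<close> is
  kept; what follows is governed by the second cut alone, so the probability will factorise.\<close>

lemma clean_cut_twice_far:
  assumes "nn_path s" "shd s \<le> R" "R + L < S" "clean_cut R L s" "clean_cut S L' s"
  shows "first_passage R (ascend (Suc L) (reach_before (R + L) S (straight_cut S L'))) s"
proof -
  have "first_passage R (\<lambda>t. straight_cut R L t \<and> clean_cut S L' t) s"
    using assms by (intro first_passage_conj) auto
  then show ?thesis
  proof (rule first_passage_mono)
    fix t assume t: "shd t = R" "straight_cut R L t \<and> clean_cut S L' t"
    then have "ascend (Suc L) (\<lambda>t. avoid (R + L) t \<and> clean_cut S L' t) t"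
      using \<open>R + L < S\<close> by (intro ascend_conj) (auto simp: straight_cut_def simp del: ascend.simps)
    then show "ascend (Suc L) (reach_before (R + L) S (straight_cut S L')) t"
      by (rule ascend_mono) (use \<open>R + L < S\<close> in \<open>auto intro: avoid_reach_before\<close>)
  qed
qed

text \<open>Here \<open>S\<close> lies on the climb of the first cut. Only the climb from
  \<open>R\<close> to \<open>S\<close> is kept, and the rest of the first cut is discarded.\<close>

lemma clean_cut_twice_near:
  assumes "nn_path s" "shd s \<le> R" "R < S" "S \<le> Suc (R + L)" "clean_cut R L s" "clean_cut S L' s"
  shows "first_passage R (ascend (S - R) (straight_cut S L')) s"
proof -
  have "first_passage R (\<lambda>t. straight_cut R L t \<and> clean_cut S L' t) s"
    using assms by (intro first_passage_conj) auto
  then show ?thesis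
  proof (rule first_passage_mono)
    fix t assume t: "shd t = R" "straight_cut R L t \<and> clean_cut S L' t"
    then have "ascend (S - shd t) (straight_cut S L') t"
      using assms by (intro ascend_overlap[of "Suc L" "avoid (R + L)"])
        (auto simp: straight_cut_def simp del: ascend.simps)
    then show "ascend (S - R) (straight_cut S L') t" using t by simp
  qed
qed

section \<open>Clean cuts and points visited exactly once\<close>

lemma first_passage_iff:
  "first_passage R G s \<longleftrightarrow> (\<exists>m. (\<forall>k<m. s !! k \<noteq> R) \<and> s !! m = R \<and> G (sdrop m s))"
proof
  assume "first_passage R G s"
  then show "\<exists>m. (\<forall>k<m. s !! k \<noteq> R) \<and> s !! m = R \<and> G (sdrop m s)"
    unfolding first_passage_def
  proof (induction rule: suntil.induct)
    case (base s)
    then show ?case by (intro exI[of _ 0]) simp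
  next
    case (step s)
    from step.IH obtain m where "\<forall>k<m. stl s !! k \<noteq> R" "stl s !! m = R" "G (sdrop m (stl s))"
      by (elim exE conjE)
    then show ?case using step.hyps(1) by (intro exI[of _ "Suc m"]) (simp add: All_less_Suc2)
  qed
next
  have "first_passage R G s" if "\<forall>k<m. s !! k \<noteq> R" "s !! m = R" "G (sdrop m s)" for m
    using that
  proof (induction m arbitrary: s)
    case 0
    then show ?case by (cases s) (simp add: first_passage_Stream)
  next
    case (Suc m)
    have "first_passage R G (stl s)"
      using Suc.prems by (intro Suc.IH) (simp_all add: All_less_Suc2)
    moreover have "shd s \<noteq> R" using Suc.prems(1)[rule_format, of 0] by simp
    ultimately show ?case by (cases s) (simp add: first_passage_Stream)
  qed
  then show "\<exists>m. (\<forall>k<m. s !! k \<noteq> R) \<and> s !! m = R \<and> G (sdrop m s) \<Longrightarrow> first_passage R G s"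
    by (elim exE conjE)
qed

lemma ascend_iff: "ascend n G s \<longleftrightarrow> (\<forall>i\<le>n. s !! i = shd s + i) \<and> G (sdrop n s)"
proof (induction n arbitrary: s)
  case (Suc n)
  have "ascend (Suc n) G s \<longleftrightarrow> shd (stl s) = Suc (shd s) \<and> (\<forall>i\<le>n. stl s !! i = shd (stl s) + i) \<and> G (sdrop n (stl s))"
    by (simp add: Suc)
  also have "\<dots> \<longleftrightarrow> (\<forall>i\<le>Suc n. s !! i = shd s + i) \<and> G (sdrop (Suc n) s)"
  proof -
    have "(\<forall>i\<le>Suc n. s !! i = shd s + i) \<longleftrightarrow> (\<forall>i\<le>n. stl s !! i = Suc (shd s + i))"
      by (subst all_nat_split) simp
    moreover have "shd (stl s) = Suc (shd s)" if "\<forall>i\<le>n. stl s !! i = Suc (shd s + i)"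
      using that[rule_format, of 0] by simp
    ultimately show ?thesis by auto
  qed
  finally show ?case .
qed simp

lemma avoid_sdrop: "avoid Q (sdrop n s) \<longleftrightarrow> (\<forall>k\<ge>n. s !! k \<noteq> Q)"
  unfolding avoid_def sdrop_snth by (auto simp: le_iff_add)

lemma clean_cut_iff:
  "clean_cut R L s \<longleftrightarrow> (\<exists>m. (\<forall>k<m. s !! k \<noteq> R) \<and> (\<forall>i\<le>Suc L. s !! (m + i) = R + i) \<and> (\<forall>k>m + L. s !! k \<noteq> R + L))"
proof -
  have "s !! m = R \<and> straight_cut R L (sdrop m s) \<longleftrightarrow>
      (\<forall>i\<le>Suc L. s !! (m + i) = R + i) \<and> (\<forall>k>m + L. s !! k \<noteq> R + L)" for m
  proof -
    have "s !! m = R \<and> straight_cut R L (sdrop m s) \<longleftrightarrow>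
      s !! m = R \<and> (\<forall>i\<le>Suc L. s !! (m + i) = s !! m + i) \<and> (\<forall>k\<ge>Suc (m + L). s !! k \<noteq> R + L)"
      unfolding straight_cut_def ascend_iff sdrop_add avoid_sdrop
      by (simp add: sdrop_snth)
    also have "\<dots> \<longleftrightarrow> s !! m = R \<and> (\<forall>i\<le>Suc L. s !! (m + i) = R + i) \<and> (\<forall>k>m + L. s !! k \<noteq> R + L)"
      by (simp only: Suc_le_eq cong: conj_cong)
    also have "\<dots> \<longleftrightarrow> (\<forall>i\<le>Suc L. s !! (m + i) = R + i) \<and> (\<forall>k>m + L. s !! k \<noteq> R + L)"
    proof -
      have "s !! m = R" if "\<forall>i\<le>Suc L. s !! (m + i) = R + i"
        using that[rule_format, of 0] by simp
      then show ?thesis by blast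
    qed
    finally show ?thesis .
  qed
  then show ?thesis unfolding first_passage_iff by (simp only: conj_assoc)
qed

lemma nn_path_intermediate:
  assumes "nn_path s" "a \<le> b" "s !! a \<le> v" "v \<le> s !! b"
  shows "\<exists>k. a \<le> k \<and> k \<le> b \<and> s !! k = v"
  using assms(2,4)
proof (induction b rule: dec_induct)
  case base
  then show ?case using assms(3) by (intro exI[of _ a]) auto
next
  case (step b)
  have "s !! Suc b = Suc (s !! b) \<or> Suc (s !! Suc b) = s !! b"
    using assms(1) unfolding nn_path_def by blast
  then consider "v \<le> s !! b" | "s !! Suc b = v" using step.prems by linarith
  then show ?case
  proof cases
    case 1
    then show ?thesis using step.IH by (meson le_SucI)
  next
    case 2
    then show ?thesis using step.hyps by (intro exI[of _ "Suc b"]) auto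
  qed
qed

lemma nn_path_before_first:
  assumes "nn_path s" "shd s \<le> R" "\<forall>k<m. s !! k \<noteq> R" "k < m"
  shows "s !! k < R"
proof (rule ccontr)
  assume "\<not> s !! k < R"
  then have "\<exists>k'. 0 \<le> k' \<and> k' \<le> k \<and> s !! k' = R"
    using assms by (intro nn_path_intermediate) auto
  then show False using assms(3,4) le_less_trans by blast
qed

text \<open>Before time \<open>m\<close> the path is below \<open>R\<close>, and after time
  \<open>m + L\<close> it stays above \<open>R + L\<close>, since unit steps cannot jump over the
  avoided point. In between it climbs through each point of the run once.\<close>

lemma clean_cut_visited_once:
  assumes nn: "nn_path s" and "shd s \<le> R" and "clean_cut R L s" and "j \<le> L"
  obtains m where "{k. s !! k = R + j} = {m}"
proof -
  from \<open>clean_cut R L s\<close> obtain m where m: "\<forall>k<m. s !! k \<noteq> R" "\<forall>i\<le>Suc L. s !! (m + i) = R + i"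
    "\<forall>k>m + L. s !! k \<noteq> R + L"
    unfolding clean_cut_iff by blast
  have after: "R + L < s !! k" if "Suc (m + L) \<le> k" for k
    using that
  proof (induction k rule: dec_induct)
    case base
    then show ?case using m(2)[rule_format, of "Suc L"] by simp
  next
    case (step k)
    have "s !! Suc k = Suc (s !! k) \<or> Suc (s !! Suc k) = s !! k"
      using nn unfolding nn_path_def by blast
    moreover have "s !! Suc k \<noteq> R + L"
      using m(3)[rule_format, of "Suc k"] step by (simp del: snth.simps)
    ultimately show ?case using step by linarith
  qed
  have "k = m + j" if "s !! k = R + j" for k
  proof -
    have "m \<le> k"
      using nn_path_before_first[OF nn assms(2) m(1), of k] that by (cases "k < m") auto
    moreover have "k \<le> m + L"
      using after[of k] that \<open>j \<le> L\<close> by (cases "k \<le> m + L") auto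
    ultimately have "s !! (m + (k - m)) = R + (k - m)" using m(2)[rule_format, of "k - m"] by simp
    then show ?thesis using that \<open>m \<le> k\<close> by simp
  qed
  then have "{k. s !! k = R + j} = {m + j}"
    using m(2) \<open>j \<le> L\<close> by auto
  then show ?thesis using that by blast
qed

text \<open>A step down from a point of the run, made on the first climb, would force a second visit
  to that point, because \<open>R + L + 1\<close> still has to be reached.\<close>

lemma clean_cutI:
  assumes nn: "nn_path s" and "shd s \<le> R" and hits: "\<And>S. \<exists>k. s !! k = S"
    and once: "\<And>j k k'. j \<le> L \<Longrightarrow> s !! k = R + j \<Longrightarrow> s !! k' = R + j \<Longrightarrow> k = k'"
  shows "clean_cut R L s"
proof -
  define m where "m = (LEAST k. s !! k = R)"
  have sm: "s !! m = R"
    unfolding m_def using hits[of R] by (metis (mono_tags, lifting) LeastI)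
  have first: "\<forall>k<m. s !! k \<noteq> R"
    unfolding m_def using not_less_Least by blast
  have up: "\<forall>i'\<le>i. s !! (m + i') = R + i'" if "i \<le> Suc L" for i
    using that
  proof (induction i)
    case 0
    then show ?case using sm by simp
  next
    case (Suc i)
    then have IH: "\<forall>i'\<le>i. s !! (m + i') = R + i'" and "i \<le> L" by auto
    have "s !! Suc (m + i) = Suc (s !! (m + i)) \<or> Suc (s !! Suc (m + i)) = s !! (m + i)"
      using nn unfolding nn_path_def by blast
    moreover have False if down: "Suc (s !! Suc (m + i)) = s !! (m + i)"
    proof -
      obtain k where k: "s !! k = Suc (R + L)" using hits by blast
      \<comment> \<open>Before time \<open>m\<close> the path is below \<open>R\<close>, and from
        \<open>m\<close> to \<open>m + i\<close> it is at most \<open>R + L\<close>; so the visit to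
        \<open>R + L + 1\<close> comes after the step down.\<close>
      have "Suc (m + i) \<le> k"
      proof (rule ccontr)
        assume "\<not> Suc (m + i) \<le> k"
        then consider "k < m" | "m \<le> k" "k - m \<le> i" by linarith
        then show False
        proof cases
          case 1
          then show False using nn_path_before_first[OF nn assms(2) first, of k] k by simp
        next
          case 2
          then show False using IH[rule_format, of "k - m"] k \<open>i \<le> L\<close> by simp
        qed
      qed
      then obtain k' where "Suc (m + i) \<le> k'" "s !! k' = R + i"
        using nn_path_intermediate[OF nn, of "Suc (m + i)" k "R + i"] k IH down \<open>i \<le> L\<close> by auto
      then show False using once[of i k' "m + i"] IH \<open>i \<le> L\<close> by auto
    qed
    ultimately have "s !! (m + Suc i) = R + Suc i" using IH by auto
    then show ?case using IH by (metis le_Suc_eq)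
  qed
  have "s !! k \<noteq> R + L" if "m + L < k" for k
    using once[of L k "m + L"] up[of L] that by auto
  then show ?thesis
    unfolding clean_cut_iff using first up[of "Suc L"] by blast
qed

section \<open>Joint probabilities of two cuts\<close>

context transient_walk
begin

text \<open>The escape probability \<open>d Q / H Q\<close> inside \<open>cut_prob R L\<close>, with
  \<open>Q = R + L\<close>, is replaced by the probability \<open>d Q / (H Q - H S)\<close> of
  reaching \<open>S\<close> before \<open>Q\<close>. The last factor is the ratio of the
  two.\<close>

lemma pr_two_cuts_far:
  assumes "R + L < S"
  shows "pr 0 (\<lambda>s. clean_cut R L s \<and> clean_cut S L' s)
    \<le> cut_prob R L * cut_prob S L' * (H (R + L) / (H (R + L) - H S))"
proof -
  let ?Q = "R + L"
  have "pr 0 (\<lambda>s. clean_cut R L s \<and> clean_cut S L' s)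
      \<le> pr 0 (first_passage R (ascend (Suc L) (reach_before ?Q S (straight_cut S L'))))"
    using assms by (intro pr_mono_AE clean_cut_twice_far) (auto simp del: ascend.simps)
  also have "\<dots> = pr R (ascend (Suc L) (reach_before ?Q S (straight_cut S L')))"
    by (rule pr_first_passage) simp_all
  also have "\<dots> = (\<Prod>j\<le>L. E (R + j)) * (d ?Q / (h S - h ?Q) * cut_prob S L')"
    using assms by (subst pr_ascend) (simp_all add: pr_reach_before pr_straight_cut lessThan_Suc_atMost)
  also have "\<dots> = cut_prob R L * cut_prob S L' * (H ?Q / (H ?Q - H S))"
    using H_pos[of ?Q] by (simp add: cut_prob_def[of R] H_diff)
  finally show ?thesis .
qed

lemma pr_two_cuts_near:
  assumes "R < S" "S \<le> Suc (R + L)"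
  shows "pr 0 (\<lambda>s. clean_cut R L s \<and> clean_cut S L' s) \<le> (\<Prod>j<S - R. E (R + j)) * cut_prob S L'"
proof -
  have "pr 0 (\<lambda>s. clean_cut R L s \<and> clean_cut S L' s)
      \<le> pr 0 (first_passage R (ascend (S - R) (straight_cut S L')))"
    using assms by (intro pr_mono_AE clean_cut_twice_near[where L=L]) auto
  also have "\<dots> = pr R (ascend (S - R) (straight_cut S L'))"
    by (rule pr_first_passage) simp_all
  also have "\<dots> = (\<Prod>j<S - R. E (R + j)) * cut_prob S L'"
    using assms by (subst pr_ascend) (simp_all add: pr_straight_cut)
  finally show ?thesis .
qed

lemma cut_prob_nonneg: "0 \<le> cut_prob R L"
  using pr_straight_cut[of R L] by (metis measure_nonneg)

end

section \<open>A second Borel--Cantelli lemma for weakly correlated events\<close>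

lemma sum_lessThan_square_symmetric:
  fixes f :: "nat \<Rightarrow> nat \<Rightarrow> real"
  assumes "\<And>i j. f i j = f j i"
  shows "(\<Sum>i<n. \<Sum>j<n. f i j) = (\<Sum>i<n. f i i) + 2 * (\<Sum>j<n. \<Sum>i<j. f i j)"
proof (induction n)
  case (Suc n)
  have "(\<Sum>i<Suc n. \<Sum>j<Suc n. f i j) = (\<Sum>i<n. \<Sum>j<n. f i j) + (\<Sum>i<n. f i n) + (\<Sum>j<n. f n j) + f n n"
    by (simp add: sum.distrib)
  moreover have "(\<Sum>j<n. f n j) = (\<Sum>i<n. f i n)"
    by (intro sum.cong refl assms)
  ultimately show ?case using Suc.IH by simp
qed simp

lemma sum_lessThan_triangle_swap:
  fixes f :: "nat \<Rightarrow> nat \<Rightarrow> real"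
  shows "(\<Sum>j<n. \<Sum>i<j. f i j) = (\<Sum>i<n. \<Sum>j\<in>{i<..<n}. f i j)"
proof (induction n)
  case (Suc n)
  have "(\<Sum>j\<in>{i<..<Suc n}. f i j) = f i n + (\<Sum>j\<in>{i<..<n}. f i j)" if "i < n" for i
  proof -
    have "{i<..<Suc n} = insert n {i<..<n}" using that by auto
    then show ?thesis by simp
  qed
  then have "(\<Sum>i<n. \<Sum>j\<in>{i<..<Suc n}. f i j) = (\<Sum>i<n. f i n) + (\<Sum>i<n. \<Sum>j\<in>{i<..<n}. f i j)"
    by (simp add: sum.distrib)
  moreover have "{n<..<Suc n} = {}" by auto
  ultimately show ?case using Suc.IH by simp
qed simp

text \<open>Second moment method. One error term is weighted by the earlier event and summed over
  the later one, the other the reverse; both sums are bounded by \<open>C\<close>, so the variance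
  of the number of events is at most linear in its mean. As the mean diverges, Chebyshev's
  inequality excludes a bounded count.\<close>

lemma (in prob_space) AE_infinitely_often_weakly_correlated:
  fixes A :: "nat \<Rightarrow> 'a set" and y w :: "nat \<Rightarrow> nat \<Rightarrow> real"
  assumes [measurable]: "\<And>n. A n \<in> events"
    and corr: "\<And>i j. i < j \<Longrightarrow>
      prob (A i \<inter> A j) \<le> prob (A i) * prob (A j) + prob (A i) * y i j + prob (A j) * w i j"
    and y: "\<And>i n. (\<Sum>j\<in>{i<..<n}. y i j) \<le> C"
    and w: "\<And>j. (\<Sum>i<j. w i j) \<le> C"
    and diverges: "\<not> summable (\<lambda>n. prob (A n))"
  shows "AE \<omega> in M. infinite {n. \<omega> \<in> A n}"
proof -
  define p where "p = (\<lambda>i. prob (A i))"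
  define \<mu> where "\<mu> = (\<lambda>n. \<Sum>i<n. p i)"
  define N where "N = (\<lambda>n \<omega>. \<Sum>i<n. indicator (A i) \<omega> :: real)"
  have p: "0 \<le> p i" "p i \<le> 1" for i by (auto simp: p_def)
  have "0 \<le> C" using w[of 0] by simp
  have [measurable]: "N n \<in> borel_measurable M" for n unfolding N_def by measurable
  have N_sq: "N n \<omega> ^ 2 = (\<Sum>i<n. \<Sum>j<n. indicator (A i \<inter> A j) \<omega>)" for n \<omega>
    unfolding N_def power2_eq_square sum_product by (simp add: indicator_inter_arith)
  have int_sq: "integrable M (\<lambda>\<omega>. N n \<omega> ^ 2)" for n
    unfolding N_sq by (intro Bochner_Integration.integrable_sum) (auto simp: integrable_indicator_iff less_top[symmetric])
  have int: "integrable M (N n)" for n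
    by (rule square_integrable_imp_integrable[OF _ int_sq]) measurable
  have exp: "expectation (N n) = \<mu> n" for n
    unfolding N_def \<mu>_def p_def
    by (subst Bochner_Integration.integral_sum) (auto simp: integrable_indicator_iff less_top[symmetric])
  have exp_sq: "expectation (\<lambda>\<omega>. N n \<omega> ^ 2) = (\<Sum>i<n. \<Sum>j<n. prob (A i \<inter> A j))" for n
    unfolding N_sq
    by (subst Bochner_Integration.integral_sum;
        (subst Bochner_Integration.integral_sum)?)
       (auto simp: integrable_indicator_iff less_top[symmetric] intro!: Bochner_Integration.integrable_sum)
  \<comment> \<open>The diagonal contributes \<open>\<mu> n\<close>. The two error terms contribute
    \<open>2 * C * \<mu> n\<close>, doubled because each pair occurs in both orders.\<close>
  have var: "variance (N n) \<le> (1 + 4 * C) * \<mu> n" for n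
  proof -
    have "(\<Sum>i<n. \<Sum>j<n. prob (A i \<inter> A j)) = \<mu> n + 2 * (\<Sum>j<n. \<Sum>i<j. prob (A i \<inter> A j))"
      by (subst sum_lessThan_square_symmetric) (auto simp: Int_commute \<mu>_def p_def)
    also have "(\<Sum>j<n. \<Sum>i<j. prob (A i \<inter> A j)) \<le> (\<Sum>j<n. \<Sum>i<j. p i * p j + p i * y i j + p j * w i j)"
      unfolding p_def by (intro sum_mono corr) auto
    also have "\<dots> = (\<Sum>j<n. \<Sum>i<j. p i * p j) + (\<Sum>i<n. p i * (\<Sum>j\<in>{i<..<n}. y i j)) + (\<Sum>j<n. p j * (\<Sum>i<j. w i j))"
      by (simp add: sum.distrib sum_lessThan_triangle_swap[of "\<lambda>i j. p i * y i j"] sum_distrib_left)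
    also have "\<dots> \<le> (\<Sum>j<n. \<Sum>i<j. p i * p j) + (\<Sum>i<n. p i * C) + (\<Sum>j<n. p j * C)"
      using p(1) y w by (intro add_mono sum_mono mult_left_mono order_refl) auto
    also have "\<dots> = (\<Sum>j<n. \<Sum>i<j. p i * p j) + 2 * C * \<mu> n"
      by (simp add: \<mu>_def sum_distrib_right[symmetric])
    finally have "(\<Sum>i<n. \<Sum>j<n. prob (A i \<inter> A j)) \<le> \<mu> n + 2 * (\<Sum>j<n. \<Sum>i<j. p i * p j) + 4 * C * \<mu> n"
      by simp
    moreover have "(\<mu> n)\<^sup>2 = (\<Sum>i<n. p i * p i) + 2 * (\<Sum>j<n. \<Sum>i<j. p i * p j)"
      unfolding \<mu>_def power2_eq_square sum_product
      by (subst sum_lessThan_square_symmetric) (auto simp: mult.commute)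
    moreover have "0 \<le> (\<Sum>i<n. p i * p i)" by (intro sum_nonneg) simp
    ultimately show ?thesis
      using variance_eq[OF int int_sq, of n] by (simp add: exp exp_sq algebra_simps)
  qed
  have unbounded: "\<exists>n. B < \<mu> n" for B
  proof (rule ccontr)
    assume "\<not> (\<exists>n. B < \<mu> n)"
    then have "(\<Sum>k\<le>n. p k) \<le> B" for n
      by (metis \<mu>_def lessThan_Suc_atMost not_less)
    then have "summable p" using p(1) by (intro bounded_imp_summable[of p B]) auto
    then show False using diverges by (simp add: p_def)
  qed
  have "AE \<omega> in M. \<exists>n. real k < N n \<omega>" for k :: nat
  proof -
    let ?F = "{\<omega> \<in> space M. \<forall>n. N n \<omega> \<le> real k}"
    have "prob ?F \<le> e" if "0 < e" for e
    proof -
      \<comment> \<open>The first bound makes a count of at most \<open>k\<close> deviate from the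
        mean by at least half the mean; the second makes the Chebyshev bound at most
        \<open>e\<close>.\<close>
      obtain n where n: "max (2 * real k + 1) (4 * (1 + 4 * C) / e) < \<mu> n"
        using unbounded by blast
      have pos: "0 < \<mu> n" using n by (auto simp: max_less_iff_conj)
      have "prob ?F \<le> prob {\<omega> \<in> space M. \<mu> n / 2 \<le> \<bar>N n \<omega> - expectation (N n)\<bar>}"
      proof (rule finite_measure_mono)
        show "?F \<subseteq> {\<omega> \<in> space M. \<mu> n / 2 \<le> \<bar>N n \<omega> - expectation (N n)\<bar>}"
        proof safe
          fix \<omega> assume "\<forall>n. N n \<omega> \<le> real k"
          then have "N n \<omega> \<le> real k" by blast
          then show "\<mu> n / 2 \<le> \<bar>N n \<omega> - expectation (N n)\<bar>" using n by (simp add: exp)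
        qed
      qed measurable
      also have "\<dots> \<le> variance (N n) / (\<mu> n / 2)\<^sup>2"
        by (rule Chebyshev_inequality) (use int_sq pos in auto)
      also have "\<dots> \<le> (1 + 4 * C) * \<mu> n / (\<mu> n / 2)\<^sup>2"
        by (intro divide_right_mono var) simp
      also have "\<dots> = 4 * (1 + 4 * C) / \<mu> n"
        using pos by (simp add: power2_eq_square field_simps)
      also have "\<dots> \<le> e"
        using n pos \<open>0 < e\<close> by (simp add: field_simps)
      finally show ?thesis .
    qed
    then have "prob ?F \<le> 0"
      by (rule field_le_epsilon[of _ 0, simplified])
    then have "prob ?F = 0" using measure_nonneg[of M ?F] by linarith
    then have "AE \<omega> in M. \<not> (\<forall>n. N n \<omega> \<le> real k)"
      by (subst (asm) prob_Collect_eq_0) auto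
    then show ?thesis by (simp add: not_le)
  qed
  then have "AE \<omega> in M. \<forall>k::nat. \<exists>n. real k < N n \<omega>"
    by (simp add: AE_all_countable)
  then show ?thesis
  proof eventually_elim
    case (elim \<omega>)
    show ?case
    proof
      assume fin: "finite {n. \<omega> \<in> A n}"
      obtain n where n: "real (card {n. \<omega> \<in> A n}) < N n \<omega>" using elim by blast
      have "N n \<omega> = real (card ({..<n} \<inter> {i. \<omega> \<in> A i}))"
        unfolding N_def by (simp add: indicator_def sum.If_cases)
      also have "\<dots> \<le> real (card {n. \<omega> \<in> A n})"
        using fin by (intro of_nat_mono card_mono) auto
      finally show False using n by simp
    qed
  qed
qed

section \<open>Asymptotics for power drifts\<close>

locale power_drift_params =
  fixes \<alpha> B :: real
  assumes \<alpha>_pos: "0 < \<alpha>" and \<alpha>_less_1: "\<alpha> < 1" and B_pos: "0 < B"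
begin

abbreviation drift :: "nat \<Rightarrow> real" where
  "drift \<equiv> power_drift B \<alpha>"

text \<open>The drift formula tends to 0, so the \<open>LEAST\<close> in the definition is
  attained.\<close>

lemma drift_cutoff: "1 \<le> drift_cutoff B \<alpha>" "B / (4 * real (drift_cutoff B \<alpha>) powr \<alpha>) < 1/2"
proof -
  have "eventually (\<lambda>i::nat. 1 \<le> i \<and> B / (4 * real i powr \<alpha>) < 1/2) sequentially"
  proof (rule eventually_conj)
    have "((\<lambda>i::nat. B / (4 * real i powr \<alpha>)) \<longlongrightarrow> 0) sequentially"
      using \<alpha>_pos B_pos by real_asymp
    then show "eventually (\<lambda>i::nat. B / (4 * real i powr \<alpha>) < 1/2) sequentially"
      by (rule order_tendstoD) simp
  qed (rule eventually_ge_at_top)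
  then have "\<exists>i::nat. 1 \<le> i \<and> B / (4 * real i powr \<alpha>) < 1/2"
    by (auto simp: eventually_sequentially)
  then have "1 \<le> drift_cutoff B \<alpha> \<and> B / (4 * real (drift_cutoff B \<alpha>) powr \<alpha>) < 1/2"
    unfolding drift_cutoff_def by (rule LeastI_ex)
  then show "1 \<le> drift_cutoff B \<alpha>" "B / (4 * real (drift_cutoff B \<alpha>) powr \<alpha>) < 1/2" by auto
qed

lemma drift_eq: "drift_cutoff B \<alpha> \<le> i \<Longrightarrow> drift i = B / (4 * real i powr \<alpha>)"
  by (simp add: power_drift_def)

lemma drift_pos: "0 < drift i"
  using drift_cutoff(1) B_pos by (auto simp: power_drift_def)

lemma powr_ratio_antimono:
  assumes "1 \<le> i" "i \<le> j" "0 \<le> c"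
  shows "c / real j powr \<alpha> \<le> c / real i powr \<alpha>"
  using assms \<alpha>_pos by (intro divide_left_mono powr_mono2) auto

lemma drift_less: "drift i < 1/2"
proof (cases "drift_cutoff B \<alpha> \<le> i")
  case True
  then have "drift i \<le> B / (4 * real (drift_cutoff B \<alpha>) powr \<alpha>)"
    using powr_ratio_antimono[of "drift_cutoff B \<alpha>" i "B / 4"] drift_cutoff(1) B_pos
    by (simp add: drift_eq)
  then show ?thesis using drift_cutoff(2) by linarith
next
  case False
  then show ?thesis using drift_cutoff(2) by (simp add: power_drift_def)
qed

sublocale walk "up_prob drift"
proof unfold_locales
  show "0 < up_prob drift i" "0 < i \<Longrightarrow> up_prob drift i < 1" for i
    using drift_pos[of i] drift_less[of i] by (auto simp: up_prob_def)
qed (simp add: up_prob_def)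

text \<open>With \<open>p\<close> the drift, the ratio of successive increments is
  \<open>(1 - 2 * p) / (1 + 2 * p)\<close>. For \<open>0 < p < 1/2\<close> it lies between
  \<open>1 - 4 * p\<close> and \<open>1 - 2 * p\<close>; the loss against the true rate affects
  constants only.\<close>

lemma d_Suc_le: "d (Suc x) \<le> d x * (1 - 2 * drift (Suc x))"
proof -
  let ?p = "drift (Suc x)"
  have p: "0 < ?p" "?p < 1/2" by (rule drift_pos drift_less)+
  have "(1/2 - ?p) \<le> (1/2 + ?p) * (1 - 2 * ?p)"
    using p mult_left_mono[of ?p "1/2" ?p] by (simp add: algebra_simps)
  moreover have "(1/2 + ?p) * d (Suc x) = (1/2 - ?p) * d x"
    using d_Suc[of x] by (simp add: up_prob_def)
  ultimately have "(1/2 + ?p) * d (Suc x) \<le> (1/2 + ?p) * (d x * (1 - 2 * ?p))"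
    using d_pos[of x] mult_right_mono[of "1/2 - ?p" "(1/2 + ?p) * (1 - 2 * ?p)" "d x"]
    by (simp add: mult_ac)
  then show ?thesis using p by (subst (asm) mult_le_cancel_left_pos) auto
qed

lemma d_Suc_ge: "d x * (1 - 4 * drift (Suc x)) \<le> d (Suc x)"
proof -
  let ?p = "drift (Suc x)"
  have p: "0 < ?p" "?p < 1/2" by (rule drift_pos drift_less)+
  have "(1/2 + ?p) * (1 - 4 * ?p) \<le> (1/2 - ?p)"
    using p by (simp add: algebra_simps)
  moreover have "(1/2 + ?p) * d (Suc x) = (1/2 - ?p) * d x"
    using d_Suc[of x] by (simp add: up_prob_def)
  ultimately have "(1/2 + ?p) * (d x * (1 - 4 * ?p)) \<le> (1/2 + ?p) * d (Suc x)"
    using d_pos[of x] mult_right_mono[of "(1/2 + ?p) * (1 - 4 * ?p)" "1/2 - ?p" "d x"]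
    by (simp add: mult_ac)
  then show ?thesis using p by (subst (asm) mult_le_cancel_left_pos) auto
qed

text \<open>The potential \<open>V R = 4 / B * R powr \<alpha> * d R\<close> decreases by at least \<open>d R\<close> in each step,
  so it bounds the tail sums of \<^const>\<open>d\<close>.\<close>

lemma sum_d_le: "\<exists>R\<^sub>0\<ge>1. \<forall>R\<ge>R\<^sub>0. \<forall>n. (\<Sum>k<n. d (k + R)) \<le> 4 / B * real R powr \<alpha> * d R"
proof -
  have "((\<lambda>R::nat. real (Suc R) powr \<alpha> - real R powr \<alpha>) \<longlongrightarrow> 0) sequentially"
    using \<alpha>_pos \<alpha>_less_1 by real_asymp
  then have "eventually (\<lambda>R::nat. real (Suc R) powr \<alpha> - real R powr \<alpha> < B / 4) sequentially"
    by (rule order_tendstoD) (use B_pos in simp)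
  then obtain R1 where R1: "\<And>R. R \<ge> R1 \<Longrightarrow> real (Suc R) powr \<alpha> - real R powr \<alpha> < B / 4"
    by (auto simp: eventually_sequentially)
  define V where "V = (\<lambda>R. 4 / B * real R powr \<alpha> * d R)"
  define R0 where "R0 = max R1 (drift_cutoff B \<alpha>)"
  have V_nonneg: "0 \<le> V R" for R using B_pos d_pos[of R] by (simp add: V_def)
  have step: "d R \<le> V R - V (Suc R)" if "R0 \<le> R" for R
  proof -
    have pos: "0 < real (Suc R) powr \<alpha>" by simp
    have "V (Suc R) \<le> 4 / B * real (Suc R) powr \<alpha> * (d R * (1 - 2 * drift (Suc R)))"
      unfolding V_def using B_pos by (intro mult_left_mono d_Suc_le) auto
    \<comment> \<open>The factor \<open>4 / B * real (Suc R) powr \<alpha>\<close> times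
      \<open>2 * drift (Suc R)\<close> is exactly 2. One unit absorbs the growth of the power, which
      is eventually below \<open>B / 4\<close> since \<open>\<alpha> < 1\<close>; the other pays for
      \<open>d R\<close>.\<close>
    also have "\<dots> = (4 / B * real (Suc R) powr \<alpha> - 2) * d R"
      using that pos B_pos by (simp add: drift_eq R0_def field_simps del: of_nat_Suc)
    also have "\<dots> \<le> (4 / B * real R powr \<alpha> - 1) * d R"
    proof (rule mult_right_mono)
      have "4 / B * (real (Suc R) powr \<alpha> - real R powr \<alpha>) \<le> 4 / B * (B / 4)"
        using R1[of R] that B_pos by (intro mult_left_mono) (auto simp: R0_def)
      then show "4 / B * real (Suc R) powr \<alpha> - 2 \<le> 4 / B * real R powr \<alpha> - 1"
        using B_pos by (simp add: right_diff_distrib)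
    qed (use d_pos[of R] in simp)
    finally show ?thesis by (simp add: V_def algebra_simps)
  qed
  have telescope: "(\<Sum>k<n. d (k + R)) \<le> V R - V (n + R)" if "R0 \<le> R" for R n
  proof (induction n)
    case (Suc n)
    then show ?case using step[of "n + R"] that by simp
  qed simp
  have "(\<Sum>k<n. d (k + R)) \<le> V R" if "R0 \<le> R" for R n
    using telescope[OF that, of n] V_nonneg[of "n + R"] by linarith
  moreover have "1 \<le> R0" using drift_cutoff(1) by (simp add: R0_def)
  ultimately show ?thesis unfolding V_def by blast
qed

lemma summable_d: "summable d"
proof -
  obtain R0 where R0: "\<And>n. (\<Sum>k<n. d (k + R0)) \<le> 4 / B * real R0 powr \<alpha> * d R0"
    using sum_d_le by blast
  have "summable (\<lambda>k. d (k + R0))"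
  proof (rule bounded_imp_summable)
    show "(\<Sum>k\<le>n. d (k + R0)) \<le> 4 / B * real R0 powr \<alpha> * d R0" for n
      using R0[of "Suc n"] by (simp only: lessThan_Suc_atMost)
  qed (simp add: less_imp_le[OF d_pos])
  then show ?thesis by (simp add: summable_iff_shift)
qed

sublocale transient_walk "up_prob drift"
  by unfold_locales (rule summable_d)

text \<open>The lower bound restates \<open>sum_d_le\<close>. For the upper bound, all ratios of
  successive increments from \<open>R\<close> on are at least \<open>1 - q\<close> with
  \<open>q = B / real R powr \<alpha>\<close>, so \<open>H R\<close> dominates a geometric series
  with sum \<open>d R / q\<close>.\<close>

lemma escape_bounds:
  "\<exists>R\<^sub>0\<ge>1. \<forall>R\<ge>R\<^sub>0. B / 4 / real R powr \<alpha> \<le> d R / H R \<and> d R / H R \<le> B / real R powr \<alpha>"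
proof -
  obtain R1 where R1: "1 \<le> R1" "\<And>R n. R \<ge> R1 \<Longrightarrow> (\<Sum>k<n. d (k + R)) \<le> 4 / B * real R powr \<alpha> * d R"
    using sum_d_le by blast
  have "((\<lambda>R::nat. B / real R powr \<alpha>) \<longlongrightarrow> 0) sequentially"
    using \<alpha>_pos B_pos by real_asymp
  then have "eventually (\<lambda>R::nat. B / real R powr \<alpha> < 1) sequentially"
    by (rule order_tendstoD) simp
  then obtain R2 where R2: "\<And>R. R \<ge> R2 \<Longrightarrow> B / real R powr \<alpha> < 1"
    by (auto simp: eventually_sequentially)
  define R0 where "R0 = Max {R1, R2, drift_cutoff B \<alpha>}"
  have "B / 4 / real R powr \<alpha> \<le> d R / H R \<and> d R / H R \<le> B / real R powr \<alpha>" if "R0 \<le> R" for R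
  proof
    have R: "R1 \<le> R" "R2 \<le> R" "drift_cutoff B \<alpha> \<le> R" "1 \<le> R"
      using that R1(1) by (auto simp: R0_def)
    have pos: "0 < real R powr \<alpha>" using R by simp
    have "H R \<le> 4 / B * real R powr \<alpha> * d R"
      unfolding H_def using R1(2)[OF R(1)] by (intro suminf_le_const summable_d_shift)
    then show "B / 4 / real R powr \<alpha> \<le> d R / H R"
      using H_pos[of R] B_pos pos by (simp add: field_simps)
    define q where "q = B / real R powr \<alpha>"
    have q: "0 < q" "q < 1" using R2[OF R(2)] pos B_pos by (auto simp: q_def)
    have geo: "d R * (1 - q) ^ k \<le> d (k + R)" for k
    proof (induction k)
      case (Suc k)
      have "4 * drift (Suc (k + R)) \<le> q"
        using R B_pos powr_ratio_antimono[of R "Suc (k + R)" B]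
        by (simp add: drift_eq q_def)
      then have "d R * (1 - q) ^ Suc k \<le> d R * (1 - q) ^ k * (1 - 4 * drift (Suc (k + R)))"
        using q d_pos[of R] by (simp add: mult_ac mult_left_mono)
      also have "\<dots> \<le> d (k + R) * (1 - 4 * drift (Suc (k + R)))"
        using Suc \<open>4 * drift (Suc (k + R)) \<le> q\<close> q by (intro mult_right_mono) auto
      also have "\<dots> \<le> d (Suc k + R)"
        using d_Suc_ge[of "k + R"] by simp
      finally show ?case .
    qed simp
    have "d R / q = (\<Sum>k. d R * (1 - q) ^ k)"
      using q by (subst suminf_mult) (auto simp: suminf_geometric summable_geometric)
    also have "\<dots> \<le> H R"
      unfolding H_def using q
      by (intro suminf_le geo summable_d_shift summable_mult summable_geometric) auto
    finally show "d R / H R \<le> B / real R powr \<alpha>"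
      using H_pos[of R] q unfolding q_def[symmetric] by (simp add: field_simps)
  qed
  moreover have "1 \<le> R0" using R1(1) by (simp add: R0_def)
  ultimately show ?thesis by blast
qed

text \<open>The difference of tails is the sum of \<open>d T\<close> over \<open>T\<close> from
  \<open>Q\<close> to \<open>S - 1\<close>. By \<open>escape_bounds\<close> and monotonicity, each
  summand is at least the value of the lower bound at \<open>S\<close>.\<close>

lemma H_gap:
  "\<exists>R\<^sub>0\<ge>1. \<forall>Q\<ge>R\<^sub>0. \<forall>S\<ge>Q. (real S - real Q) * (B / 4 / real S powr \<alpha>) * H S \<le> H Q - H S"
proof -
  obtain R0 where R0: "1 \<le> R0" "\<And>R. R \<ge> R0 \<Longrightarrow> B / 4 / real R powr \<alpha> \<le> d R / H R"
    using escape_bounds by blast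
  have "(real S - real Q) * (B / 4 / real S powr \<alpha>) * H S \<le> H Q - H S" if "R0 \<le> Q" "Q \<le> S" for Q S
  proof -
    define c where "c = B / 4 / real S powr \<alpha> * H S"
    have "(real T - real Q) * c \<le> H Q - H T" if "Q \<le> T" "T \<le> S" for T
      using that
    proof (induction T rule: dec_induct)
      case (step T)
      have "B / 4 / real S powr \<alpha> \<le> B / 4 / real T powr \<alpha>"
        using step \<open>R0 \<le> Q\<close> R0(1) B_pos by (intro powr_ratio_antimono) auto
      also have "\<dots> \<le> d T / H T"
        using step \<open>R0 \<le> Q\<close> by (intro R0(2)) auto
      finally have "c \<le> d T / H T * H S"
        unfolding c_def using H_pos[of S] by (intro mult_right_mono) auto
      also have "\<dots> \<le> d T / H T * H T"
        using H_antimono[of T S] step d_pos[of T] H_pos[of T] by (intro mult_left_mono) auto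
      also have "\<dots> = d T" using H_pos[of T] by simp
      finally show ?case using step by (simp add: H_Suc algebra_simps)
    qed simp
    from this[of S] that show ?thesis by (simp add: c_def mult.assoc)
  qed
  then show ?thesis using R0(1) by blast
qed

section \<open>Run lengths and the probability of a cut\<close>

definition run :: "real \<Rightarrow> nat \<Rightarrow> nat" where
  "run \<epsilon> R = nat \<lfloor>f_star \<alpha> R \<epsilon>\<rfloor>"



lemma f_star_nonneg: "1 \<le> R \<Longrightarrow> 0 \<le> \<epsilon> \<Longrightarrow> 0 \<le> f_star \<alpha> R \<epsilon>"
  using \<alpha>_less_1 by (simp add: f_star_def)

lemma le_run_iff: "1 \<le> R \<Longrightarrow> 0 \<le> \<epsilon> \<Longrightarrow> j \<le> run \<epsilon> R \<longleftrightarrow> real j \<le> f_star \<alpha> R \<epsilon>"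
  using f_star_nonneg[of R \<epsilon>] unfolding run_def by (simp add: le_nat_iff le_floor_iff)

lemma run_bounds:
  assumes "1 \<le> R" "0 \<le> \<epsilon>"
  shows "real (run \<epsilon> R) \<le> f_star \<alpha> R \<epsilon>" "f_star \<alpha> R \<epsilon> \<le> real (Suc (run \<epsilon> R))"
  using f_star_nonneg[OF assms] unfolding run_def by linarith+

lemma two_powr_f_star:
  "1 \<le> R \<Longrightarrow> 2 powr (f_star \<alpha> R \<epsilon>) = real R powr ((1 + \<epsilon>) * (1 - \<alpha>))"
  by (simp add: powr_def f_star_def)

text \<open>Without rounding, \<open>2 powr (- f_star \<alpha> R \<epsilon>)\<close> is the stated
  power of \<open>R\<close>; the integer part costs a factor of at most 2.\<close>

lemma half_power_run:
  assumes "1 \<le> R" "0 \<le> \<epsilon>"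
  shows "(1/2) ^ Suc (run \<epsilon> R) \<le> real R powr (- ((1 + \<epsilon>) * (1 - \<alpha>)))"
    and "real R powr (- ((1 + \<epsilon>) * (1 - \<alpha>))) / 2 \<le> (1/2) ^ Suc (run \<epsilon> R)"
proof -
  let ?n = "Suc (run \<epsilon> R)" and ?f = "f_star \<alpha> R \<epsilon>"
  have half: "(1/2) ^ ?n = (2::real) powr (- real ?n)"
    by (simp only: powr_minus powr_realpow[OF zero_less_numeral] power_one_over inverse_eq_divide)
  have R: "real R powr (- ((1 + \<epsilon>) * (1 - \<alpha>))) = 2 powr (- ?f)"
    using two_powr_f_star[OF assms(1), of \<epsilon>] by (simp add: powr_minus)
  show "(1/2) ^ ?n \<le> real R powr (- ((1 + \<epsilon>) * (1 - \<alpha>)))"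
    unfolding half R using run_bounds[OF assms] by (intro powr_mono) auto
  have "(2::real) powr (- ?f) / 2 = 2 powr (- ?f - 1)"
    by (simp add: powr_diff)
  also have "\<dots> \<le> 2 powr (- real ?n)"
    using run_bounds[OF assms] by (intro powr_mono) auto
  finally show "real R powr (- ((1 + \<epsilon>) * (1 - \<alpha>))) / 2 \<le> (1/2) ^ ?n"
    unfolding half R .
qed

text \<open>The probabilities of the steps up are at most \<open>(1 + x) / 2\<close> with
  \<open>x = B / (2 * real R powr \<alpha>)\<close>. As the run is logarithmic, \<open>x\<close>
  times its length stays below 1, so the drift adds a factor of at most \<open>exp 1\<close>. The
  escape probability contributes the remaining power \<open>- \<alpha>\<close>.\<close>

lemma cut_prob_le:
  assumes "0 \<le> \<epsilon>"
  shows "\<exists>R\<^sub>0\<ge>1. \<forall>R\<ge>R\<^sub>0. cut_prob R (run \<epsilon> R) \<le> exp 1 * B * real R powr (- 1 - \<epsilon> * (1 - \<alpha>))"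
proof -
  obtain R1 where R1: "1 \<le> R1" "\<And>R. R \<ge> R1 \<Longrightarrow> d R / H R \<le> B / real R powr \<alpha>"
    using escape_bounds by blast
  have "((\<lambda>R::nat. B / (2 * real R powr \<alpha>) * ((1 + \<epsilon>) * (1 - \<alpha>) * ln (real R) / ln 2 + 1)) \<longlongrightarrow> 0) sequentially"
    using \<alpha>_pos by real_asymp
  then have "eventually (\<lambda>R::nat. B / (2 * real R powr \<alpha>) * (f_star \<alpha> R \<epsilon> + 1) < 1) sequentially"
    unfolding f_star_def by (rule order_tendstoD) simp
  then obtain R2 where R2: "\<And>R. R \<ge> R2 \<Longrightarrow> B / (2 * real R powr \<alpha>) * (f_star \<alpha> R \<epsilon> + 1) < 1"
    by (auto simp: eventually_sequentially)
  define R0 where "R0 = Max {R1, R2, drift_cutoff B \<alpha>}"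
  have "cut_prob R (run \<epsilon> R) \<le> exp 1 * B * real R powr (- 1 - \<epsilon> * (1 - \<alpha>))" if "R0 \<le> R" for R
  proof -
    have R: "R1 \<le> R" "R2 \<le> R" "drift_cutoff B \<alpha> \<le> R" "1 \<le> R"
      using that R1(1) by (auto simp: R0_def)
    let ?L = "run \<epsilon> R" and ?x = "B / (2 * real R powr \<alpha>)"
    have x: "0 \<le> ?x" using B_pos by simp
    have "up_prob drift (R + j) \<le> (1 + ?x) / 2" for j
      using R powr_ratio_antimono[of R "R + j" "B / 4"] B_pos
      by (simp add: up_prob_def drift_eq field_simps)
    then have "(\<Prod>j\<le>?L. up_prob drift (R + j)) \<le> (\<Prod>j\<le>?L. (1 + ?x) / 2)"
      using E_pos by (intro prod_mono) (auto simp: less_imp_le)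
    also have "\<dots> = (1 + ?x) ^ Suc ?L * (1/2) ^ Suc ?L"
      by (simp add: power_mult_distrib[symmetric] del: power_Suc)
    also have "\<dots> \<le> exp 1 * real R powr (- ((1 + \<epsilon>) * (1 - \<alpha>)))"
    proof (rule mult_mono)
      have "(1 + ?x) ^ Suc ?L \<le> exp ?x ^ Suc ?L"
        using x by (intro power_mono exp_ge_add_one_self) auto
      also have "\<dots> = exp (?x * real (Suc ?L))"
        by (simp add: exp_of_nat_mult[symmetric] mult.commute del: power_Suc of_nat_Suc)
      also have "\<dots> \<le> exp 1"
      proof -
        have "?x * real (Suc ?L) \<le> ?x * (f_star \<alpha> R \<epsilon> + 1)"
          using run_bounds(1)[OF R(4) assms] x by (intro mult_left_mono) auto
        then show ?thesis using R2[OF R(2)] by simp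
      qed
      finally show "(1 + ?x) ^ Suc ?L \<le> exp 1" .
    qed (use half_power_run(1)[OF R(4) assms] in auto)
    finally have 1: "(\<Prod>j\<le>?L. up_prob drift (R + j)) \<le> exp 1 * real R powr (- ((1 + \<epsilon>) * (1 - \<alpha>)))" .
    have "d (R + ?L) / H (R + ?L) \<le> B / real (R + ?L) powr \<alpha>"
      using R by (intro R1(2)) auto
    also have "\<dots> \<le> B / real R powr \<alpha>"
      using R B_pos by (intro powr_ratio_antimono) auto
    finally have 2: "d (R + ?L) / H (R + ?L) \<le> B / real R powr \<alpha>" .
    have "cut_prob R ?L \<le> exp 1 * real R powr (- ((1 + \<epsilon>) * (1 - \<alpha>))) * (B / real R powr \<alpha>)"
      unfolding cut_prob_def using d_pos[of "R + ?L"] H_pos[of "R + ?L"]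
      by (intro mult_mono 1 2) auto
    also have "\<dots> = exp 1 * B * real R powr (- ((1 + \<epsilon>) * (1 - \<alpha>)) - \<alpha>)"
      by (simp add: powr_diff)
    also have "- ((1 + \<epsilon>) * (1 - \<alpha>)) - \<alpha> = - 1 - \<epsilon> * (1 - \<alpha>)"
      by (simp add: algebra_simps)
    finally show ?thesis .
  qed
  moreover have "1 \<le> R0" using R1(1) by (simp add: R0_def)
  ultimately show ?thesis by blast
qed

text \<open>Each step up has probability at least 1/2. The constant is \<open>B / 4\<close> from the
  escape bound, times 1/2 for rounding the run, times 1/2 because \<open>R + L\<close> is at most
  \<open>2 * R\<close>.\<close>

lemma cut_prob_ge:
  "\<exists>R\<^sub>0\<ge>1. \<forall>R\<ge>R\<^sub>0. B / 16 / real R \<le> cut_prob R (run 0 R)"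
proof -
  obtain R1 where R1: "1 \<le> R1" "\<And>R. R \<ge> R1 \<Longrightarrow> B / 4 / real R powr \<alpha> \<le> d R / H R"
    using escape_bounds by blast
  have "((\<lambda>R::nat. (1 + 0) * (1 - \<alpha>) * ln (real R) / ln 2 / real R) \<longlongrightarrow> 0) sequentially"
    by real_asymp
  then have "eventually (\<lambda>R::nat. f_star \<alpha> R 0 / real R < 1) sequentially"
    unfolding f_star_def by (rule order_tendstoD) simp
  then obtain R2 where R2: "\<And>R. R \<ge> R2 \<Longrightarrow> f_star \<alpha> R 0 / real R < 1"
    by (auto simp: eventually_sequentially)
  have "B / 16 / real R \<le> cut_prob R (run 0 R)" if "max R1 R2 \<le> R" for R
  proof -
    have R: "R1 \<le> R" "R2 \<le> R" "1 \<le> R" using that R1(1) by auto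
    let ?L = "run 0 R"
    have L: "real (R + ?L) \<le> 2 * real R"
      using R2[OF R(2)] run_bounds(1)[OF R(3), of 0] R(3) by (simp add: field_simps)
    have "real R powr (- (1 - \<alpha>)) / 2 \<le> (1/2) ^ Suc ?L"
      using half_power_run(2)[OF R(3), of 0] by simp
    also have "\<dots> = (\<Prod>j\<le>?L. 1/2)" by simp
    also have "\<dots> \<le> (\<Prod>j\<le>?L. up_prob drift (R + j))"
      using drift_pos by (intro prod_mono) (auto simp: up_prob_def less_imp_le)
    finally have 1: "real R powr (- (1 - \<alpha>)) / 2 \<le> (\<Prod>j\<le>?L. up_prob drift (R + j))" .
    have "real (R + ?L) powr \<alpha> \<le> (2 * real R) powr \<alpha>"
      using L \<alpha>_pos by (intro powr_mono2) auto
    also have "\<dots> = 2 powr \<alpha> * real R powr \<alpha>" by (simp add: powr_mult)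
    also have "\<dots> \<le> 2 powr 1 * real R powr \<alpha>"
      using \<alpha>_less_1 by (intro mult_right_mono powr_mono) auto
    finally have "real (R + ?L) powr \<alpha> \<le> 2 * real R powr \<alpha>" by simp
    then have "B / 4 / (2 * real R powr \<alpha>) \<le> B / 4 / real (R + ?L) powr \<alpha>"
      using B_pos R(3) by (intro divide_left_mono) auto
    also have "\<dots> \<le> d (R + ?L) / H (R + ?L)"
      using R by (intro R1(2)) auto
    finally have 2: "B / 4 / (2 * real R powr \<alpha>) \<le> d (R + ?L) / H (R + ?L)" .
    have "real R powr (- (1 - \<alpha>)) / 2 * (B / 4 / (2 * real R powr \<alpha>)) \<le> cut_prob R ?L"
      unfolding cut_prob_def using B_pos E_pos
      by (intro mult_mono 1 2 prod_nonneg) (auto simp: less_imp_le)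
    moreover have "real R powr (- (1 - \<alpha>)) / 2 * (B / 4 / (2 * real R powr \<alpha>)) = B / 16 * real R powr (- (1 - \<alpha>) - \<alpha>)"
      by (simp add: powr_diff)
    moreover have "real R powr (- (1 - \<alpha>) - \<alpha>) = 1 / real R"
      using R(3) by (simp add: powr_minus_divide)
    ultimately show ?thesis by simp
  qed
  moreover have "1 \<le> max R1 R2" using R1(1) by simp
  ultimately show ?thesis by blast
qed


lemma up_prob_le: "\<exists>R\<^sub>0. \<forall>R\<ge>R\<^sub>0. up_prob drift R \<le> 3/4"
proof -
  have "((\<lambda>R::nat. B / (4 * real R powr \<alpha>)) \<longlongrightarrow> 0) sequentially"
    using \<alpha>_pos B_pos by real_asymp
  then have "eventually (\<lambda>R::nat. B / (4 * real R powr \<alpha>) < 1/4) sequentially"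
    by (rule order_tendstoD) simp
  then have "eventually (\<lambda>R. up_prob drift R \<le> 3/4) sequentially"
    using eventually_ge_at_top[of "max 1 (drift_cutoff B \<alpha>)"]
    by eventually_elim (simp add: up_prob_def drift_eq)
  then show ?thesis by (simp add: eventually_sequentially)
qed

lemma sum_geometric_3_4: "(\<Sum>i<j. (3/4 :: real) ^ (j - i)) \<le> 3"
proof -
  have "(\<Sum>i<j. (3/4 :: real) ^ (j - i)) = 3 - 3 * (3/4) ^ j"
  proof (induction j)
    case (Suc j)
    have "(\<Sum>i<Suc j. (3/4 :: real) ^ (Suc j - i)) = (\<Sum>i<j. 3/4 * (3/4) ^ (j - i)) + 3/4"
      by (simp add: Suc_diff_le)
    also have "\<dots> = 3/4 * (\<Sum>i<j. (3/4) ^ (j - i)) + 3/4"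
      by (simp only: sum_distrib_left)
    finally show ?case using Suc by simp
  qed simp
  then show ?thesis by simp
qed

text \<open>Pairs whose second cut starts on the climb of the first are charged to \<open>w\<close>,
  which decays geometrically in their distance. For all other pairs the decoupling factor exceeds 1
  by \<open>H S / (H Q - H S)\<close>, and this excess is charged to \<open>y\<close>.\<close>

lemma AE_infinitely_many_cuts: "AE s in K 0. infinite {R. clean_cut R (run 0 R) s}"
proof -
  obtain R1 where R1: "1 \<le> R1" "\<And>R. R \<ge> R1 \<Longrightarrow> cut_prob R (run 0 R) \<le> exp 1 * B * real R powr (- 1)"
    using cut_prob_le[of 0] by auto
  obtain R2 where R2: "1 \<le> R2" "\<And>R. R \<ge> R2 \<Longrightarrow> B / 16 / real R \<le> cut_prob R (run 0 R)"
    using cut_prob_ge by auto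
  obtain R3 where R3: "1 \<le> R3"
    "\<And>Q S. Q \<ge> R3 \<Longrightarrow> S \<ge> Q \<Longrightarrow> (real S - real Q) * (B / 4 / real S powr \<alpha>) * H S \<le> H Q - H S"
    using H_gap by blast
  obtain R4 where R4: "\<And>R. R \<ge> R4 \<Longrightarrow> up_prob drift R \<le> 3/4"
    using up_prob_le by blast
  define R0 where "R0 = Max {R1, R2, R3, R4}"
  have R0: "R1 \<le> R0" "R2 \<le> R0" "R3 \<le> R0" "R4 \<le> R0" "1 \<le> R0"
    using R1(1) by (auto simp: R0_def)
  define Q where "Q = (\<lambda>i. R0 + i + run 0 (R0 + i))"
  define a where "a = (\<lambda>i. cut_prob (R0 + i) (run 0 (R0 + i)))"
  define A where "A = (\<lambda>i. {s. clean_cut (R0 + i) (run 0 (R0 + i)) s})"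
  \<comment> \<open>A bound for the excess at distance \<open>m\<close> from the top of the first
    run; it is summable because \<open>\<alpha> - 2 < -1\<close>.\<close>
  define g where "g = (\<lambda>m::nat. 4 * exp 1 * real m powr (\<alpha> - 2))"
  define y where "y = (\<lambda>i j. if Q i < R0 + j then g (R0 + j - Q i) else 0)"
  define w where "w = (\<lambda>i j. (3/4 :: real) ^ (j - i))"
  have g: "summable g" "0 \<le> g m" for m
    using \<alpha>_less_1 unfolding g_def by (auto intro!: summable_mult simp: summable_real_powr_iff)
  have a_nonneg: "0 \<le> a i" for i by (simp add: a_def cut_prob_nonneg)
  have pa: "measure (K 0) (A i) = a i" for i
    by (simp add: A_def a_def pr_cut)
  have "AE s in K 0. infinite {i. s \<in> A i}"
  proof (rule prob_space.AE_infinitely_often_weakly_correlated[OF prob_space_K, where y=y and w=w and C="max 3 (suminf g)"])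
    show "A i \<in> sets (K 0)" for i
      by (simp add: A_def pred_stream_sets)
  next
    fix i j :: nat assume "i < j"
    define R S where "R = R0 + i" and "S = R0 + j"
    have RS: "R < S" "R0 \<le> R" "R0 \<le> S" using \<open>i < j\<close> by (auto simp: R_def S_def)
    have AA: "measure (K 0) (A i \<inter> A j) = pr 0 (\<lambda>s. clean_cut R (run 0 R) s \<and> clean_cut S (run 0 S) s)"
      by (simp add: A_def R_def S_def Collect_conj_eq)
    have y_nonneg: "0 \<le> y i j" using g(2) by (simp add: y_def)
    have w_nonneg: "0 \<le> w i j" by (simp add: w_def)
    show "measure (K 0) (A i \<inter> A j) \<le> measure (K 0) (A i) * measure (K 0) (A j)
        + measure (K 0) (A i) * y i j + measure (K 0) (A j) * w i j"
      unfolding pa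
    proof (cases "S \<le> Suc (R + run 0 R)")
      case True
      have "measure (K 0) (A i \<inter> A j) \<le> (\<Prod>k<S - R. up_prob drift (R + k)) * a j"
        unfolding AA a_def using pr_two_cuts_near[OF RS(1) True] by (simp add: S_def)
      also have "(\<Prod>k<S - R. up_prob drift (R + k)) \<le> (\<Prod>k<S - R. 3/4)"
        using R4 R0 RS E_pos by (intro prod_mono) (auto simp: less_imp_le)
      also have "\<dots> = w i j" by (simp add: w_def R_def S_def)
      finally have "measure (K 0) (A i \<inter> A j) \<le> w i j * a j"
        using a_nonneg by (simp add: mult_right_mono)
      then show "measure (K 0) (A i \<inter> A j) \<le> a i * a j + a i * y i j + a j * w i j"
        using a_nonneg[of i] a_nonneg[of j] y_nonneg by (simp add: mult.commute add_increasing)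
    next
      case False
      let ?Q = "Q i"
      have Q: "?Q < S" "R0 \<le> ?Q" "?Q = R + run 0 R" using False by (auto simp: Q_def R_def)
      define \<delta> where "\<delta> = H ?Q - H S"
      have S: "0 < real S powr \<alpha>" "0 < real S" using RS R0 by auto
      have m: "real (S - ?Q) = real S - real ?Q" "0 < real S - real ?Q" using Q by auto
      have gap: "(real S - real ?Q) * (B / 4 / real S powr \<alpha>) * H S \<le> \<delta>"
        unfolding \<delta>_def using Q R0 by (intro R3(2)) auto
      have gap_pos: "0 < (real S - real ?Q) * (B / 4 / real S powr \<alpha>) * H S"
        using m S B_pos H_pos[of S] by simp
      then have "0 < \<delta>" using gap by linarith
      have "H S / \<delta> \<le> H S / ((real S - real ?Q) * (B / 4 / real S powr \<alpha>) * H S)"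
        by (rule divide_left_mono[OF gap less_imp_le[OF H_pos] mult_pos_pos[OF \<open>0 < \<delta>\<close> gap_pos]])
      also have "\<dots> = 4 * real S powr \<alpha> / (B * (real S - real ?Q))"
        using H_pos[of S] S m B_pos by (simp add: field_simps)
      finally have ratio: "H S / \<delta> \<le> 4 * real S powr \<alpha> / (B * (real S - real ?Q))" .
      have "a j * (H S / \<delta>) \<le> exp 1 * B * real S powr (- 1) * (4 * real S powr \<alpha> / (B * (real S - real ?Q)))"
        using R1(2)[of S] R0 RS H_pos[of S] \<open>0 < \<delta>\<close> B_pos
        by (intro mult_mono ratio) (auto simp: a_def S_def)
      also have "\<dots> = 4 * exp 1 * real S powr (\<alpha> - 1) / (real S - real ?Q)"
        using B_pos S m by (simp add: powr_diff powr_minus field_simps)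
      \<comment> \<open>The exponent \<open>\<alpha> - 1\<close> is negative and
        \<open>S - ?Q\<close> is at most \<open>S\<close>, so the bound can be made to depend on the
        distance alone.\<close>
      also have "\<dots> \<le> 4 * exp 1 * real (S - ?Q) powr (\<alpha> - 1) / (real S - real ?Q)"
        using m \<alpha>_less_1 by (intro divide_right_mono mult_left_mono powr_mono2') auto
      also have "\<dots> = g (S - ?Q)"
        using m powr_diff[of "real (S - ?Q)" "\<alpha> - 1" 1] by (simp add: g_def)
      also have "\<dots> = y i j" using Q by (simp add: y_def S_def)
      finally have *: "a j * (H S / \<delta>) \<le> y i j" .
      have "measure (K 0) (A i \<inter> A j) \<le> a i * a j * (H ?Q / \<delta>)"
        unfolding AA a_def \<delta>_def Q(3) using pr_two_cuts_far[of R "run 0 R" S "run 0 S"] Q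
        by (simp add: R_def S_def)
      also have "H ?Q / \<delta> = 1 + H S / \<delta>"
        using \<open>0 < \<delta>\<close> by (simp add: \<delta>_def field_simps)
      also have "a i * a j * (1 + H S / \<delta>) = a i * a j + a i * (a j * (H S / \<delta>))"
        by (simp add: algebra_simps)
      also have "\<dots> \<le> a i * a j + a i * y i j"
        using * a_nonneg[of i] by (intro add_left_mono mult_left_mono) auto
      finally show "measure (K 0) (A i \<inter> A j) \<le> a i * a j + a i * y i j + a j * w i j"
        using a_nonneg[of j] w_nonneg by (simp add: add_increasing2)
    qed
  next
    fix i n :: nat
    define J where "J = {j \<in> {i<..<n}. Q i < R0 + j}"
    \<comment> \<open>For fixed \<open>i\<close> the distances belonging to different
      \<open>j\<close> are different, so the sum is part of the series of \<open>g\<close>.\<close>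
    have "(\<Sum>j\<in>{i<..<n}. y i j) = (\<Sum>j\<in>J. g (R0 + j - Q i))"
      unfolding J_def y_def by (subst sum.inter_filter[symmetric]) auto
    also have "\<dots> = sum g ((\<lambda>j. R0 + j - Q i) ` J)"
      by (subst sum.reindex) (auto simp: J_def inj_on_def)
    also have "\<dots> \<le> suminf g"
      using g by (intro sum_le_suminf) (auto simp: J_def)
    finally show "(\<Sum>j\<in>{i<..<n}. y i j) \<le> max 3 (suminf g)" by simp
  next
    show "(\<Sum>i<j. w i j) \<le> max 3 (suminf g)" for j
      using sum_geometric_3_4[of j] by (simp add: w_def)
  next
    show "\<not> summable (\<lambda>i. measure (K 0) (A i))"
    proof
      assume "summable (\<lambda>i. measure (K 0) (A i))"
      then have "summable (\<lambda>i. B / 16 / real (i + R0))"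
      proof (rule summable_comparison_test'[where N=0])
        show "norm (B / 16 / real (i + R0)) \<le> measure (K 0) (A i)" for i
          using R2(2)[of "i + R0"] R0 B_pos by (simp add: pa a_def add.commute del: of_nat_add)
      qed
      then have "summable (\<lambda>i. B / 16 / real i)" 
        by (rule summable_iff_shift[where f="\<lambda>i. B / 16 / real i", THEN iffD1])
      then have "summable (\<lambda>i. 16 / B * (B / 16 / real i))" by (rule summable_mult)
      then have "summable (\<lambda>i. inverse (real i))" using B_pos by (simp add: inverse_eq_divide)
      then show False using not_summable_harmonic[where 'a=real] by blast
    qed
  qed
  then show ?thesis
  proof eventually_elim
    case (elim s)
    then have "infinite ((\<lambda>i. R0 + i) ` {i. s \<in> A i})"
      by (subst finite_image_iff) (auto simp: inj_on_def)
    moreover have "(\<lambda>i. R0 + i) ` {i. s \<in> A i} \<subseteq> {R. clean_cut R (run 0 R) s}"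
      by (auto simp: A_def)
    ultimately show ?case using finite_subset by blast
  qed
qed

text \<open>The exponent in \<open>cut_prob_le\<close> is below -1 for positive \<epsilon>, so the
  first Borel--Cantelli lemma applies.\<close>

lemma AE_finitely_many_cuts:
  assumes "0 < \<epsilon>"
  shows "AE s in K 0. \<forall>\<^sub>F R in sequentially. \<not> clean_cut R (run \<epsilon> R) s"
proof -
  let ?A = "\<lambda>R. {s. clean_cut R (run \<epsilon> R) s}"
  obtain R0 where R0: "\<And>R. R \<ge> R0 \<Longrightarrow> cut_prob R (run \<epsilon> R) \<le> exp 1 * B * real R powr (- 1 - \<epsilon> * (1 - \<alpha>))"
    using cut_prob_le[of \<epsilon>] assms by auto
  have "summable (\<lambda>R. exp 1 * B * real R powr (- 1 - \<epsilon> * (1 - \<alpha>)))"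
    using assms \<alpha>_less_1 by (intro summable_mult) (simp add: summable_real_powr_iff)
  then have "summable (\<lambda>R. measure (K 0) (?A R))"
    by (rule summable_comparison_test'[where N=R0]) (use R0 in \<open>auto simp: pr_cut cut_prob_nonneg\<close>)
  then have "AE s in K 0. \<forall>\<^sub>F R in sequentially. s \<in> space (K 0) - ?A R"
    by (intro borel_cantelli_AE1) (auto simp: pred_stream_sets less_top[symmetric])
  then show ?thesis by simp
qed

end

section \<open>Transfer of both almost sure statements to the given walk\<close>

theorem theorem3p5:
  fixes \<alpha> B :: real and M :: "'a measure" and X :: "nat \<Rightarrow> 'a \<Rightarrow> nat"
  assumes "0 < \<alpha>" and "\<alpha> < 1" and "B > 0"
    and "nn_walk M X (power_drift B \<alpha>)"
  shows "(AE \<omega> in M. infinite {R::nat. \<forall>j::nat. real j \<le> g_star \<alpha> R \<longrightarrow>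
            local_time X \<omega> (R + j) = 1})
       \<and> (AE \<omega> in M. \<forall>\<epsilon>>0. \<exists>R\<^sub>0::nat. \<forall>R\<ge>R\<^sub>0. \<exists>S::nat.
            R \<le> S \<and> real S \<le> real R + f_star \<alpha> R \<epsilon> \<and> local_time X \<omega> S > 1)"
proof -
  interpret power_drift_params \<alpha> B by unfold_locales (fact assms)+
  let ?path = "\<lambda>\<omega>. to_stream (\<lambda>n. X n \<omega>)"
  have path: "?path \<omega> !! k = X k \<omega>" for \<omega> k by (simp add: to_stream_def)
  have transfer: "AE \<omega> in M. P (?path \<omega>)" if "AE s in K 0. P s" for P
    using that nn_walk_distr[OF assms(4) walk_axioms] by (metis AE_distrD)
  show ?thesis
  proof
    have "AE s in K 0. (shd s = 0 \<and> nn_path s) \<and> infinite {R. clean_cut R (run 0 R) s}"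
      by (intro AE_conjI AE_K_nn AE_infinitely_many_cuts)
    from transfer[OF this]
    show "AE \<omega> in M. infinite {R::nat. \<forall>j::nat. real j \<le> g_star \<alpha> R \<longrightarrow> local_time X \<omega> (R + j) = 1}"
    proof eventually_elim
      case (elim \<omega>)
      have "local_time X \<omega> (R + j) = 1"
        if cut: "clean_cut R (run 0 R) (?path \<omega>)" and "1 \<le> R" and j: "real j \<le> g_star \<alpha> R" for R j
      proof -
        have "j \<le> run 0 R" using j \<open>1 \<le> R\<close> by (simp add: le_run_iff g_star_def)
        then obtain m where "{k. ?path \<omega> !! k = R + j} = {m}"
          using clean_cut_visited_once[OF _ _ cut] elim by auto
        then show ?thesis by (simp add: local_time_def path one_enat_def)
      qed
      \<comment> \<open>The comparison of \<open>run\<close> with \<open>g_star\<close> is available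
        for \<open>R \<ge> 1\<close>; dropping the single level 0 keeps the set infinite.\<close>
      then have "{R. clean_cut R (run 0 R) (?path \<omega>)} - {0} \<subseteq>
          {R. \<forall>j. real j \<le> g_star \<alpha> R \<longrightarrow> local_time X \<omega> (R + j) = 1}"
        by auto
      moreover have "infinite ({R. clean_cut R (run 0 R) (?path \<omega>)} - {0})"
        using elim by simp
      ultimately show ?case using finite_subset by blast
    qed
    \<comment> \<open>The exceptional null set must not depend on \<epsilon>. Hence only the
      countably many values \<open>1 / (n + 1)\<close> are treated, and monotonicity of
      \<open>f_star\<close> in \<epsilon> covers the others.\<close>
    have "AE s in K 0. (shd s = 0 \<and> nn_path s) \<and> (\<forall>S. \<exists>k. s !! k = S) \<and>
        (\<forall>n::nat. \<forall>\<^sub>F R in sequentially. \<not> clean_cut R (run (inverse (Suc n)) R) s)"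
      by (intro AE_conjI AE_K_nn AE_hits AE_all_countable[THEN iffD2] allI AE_finitely_many_cuts) simp
    from transfer[OF this]
    show "AE \<omega> in M. \<forall>\<epsilon>>0. \<exists>R\<^sub>0::nat. \<forall>R\<ge>R\<^sub>0. \<exists>S::nat.
            R \<le> S \<and> real S \<le> real R + f_star \<alpha> R \<epsilon> \<and> local_time X \<omega> S > 1"
    proof eventually_elim
      case (elim \<omega>)
      show ?case
      proof (intro allI impI)
        fix \<epsilon> :: real assume "0 < \<epsilon>"
        then obtain n where n: "inverse (real (Suc n)) < \<epsilon>" using reals_Archimedean by blast
        let ?e = "inverse (real (Suc n))"
        obtain R0 where R0: "\<And>R. R \<ge> R0 \<Longrightarrow> \<not> clean_cut R (run ?e R) (?path \<omega>)"
          using elim unfolding eventually_sequentially by blast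
        have "\<exists>S. R \<le> S \<and> real S \<le> real R + f_star \<alpha> R \<epsilon> \<and> local_time X \<omega> S > 1"
          if "max 1 R0 \<le> R" for R
        proof -
          \<comment> \<open>Every point is visited at least once, so without a repeated visit in the
            run \<open>clean_cutI\<close> would produce a clean cut.\<close>
          have "\<exists>j k k'. j \<le> run ?e R \<and> X k \<omega> = R + j \<and> X k' \<omega> = R + j \<and> k \<noteq> k'"
          proof (rule ccontr)
            assume "\<not> ?thesis"
            then have "clean_cut R (run ?e R) (?path \<omega>)"
              using elim by (intro clean_cutI) (auto simp: path)
            then show False using R0[of R] that by simp
          qed
          then obtain j k k' where j: "j \<le> run ?e R" and k: "X k \<omega> = R + j" "X k' \<omega> = R + j" "k \<noteq> k'"
            by blast
          have "real j \<le> f_star \<alpha> R ?e"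
            using j that by (subst (asm) le_run_iff) auto
          also have "\<dots> \<le> f_star \<alpha> R \<epsilon>"
            unfolding f_star_def using n that \<alpha>_less_1
            by (intro divide_right_mono mult_right_mono) auto
          finally have "real (R + j) \<le> real R + f_star \<alpha> R \<epsilon>" by simp
          moreover have "1 < card {k. X k \<omega> = R + j}" if "finite {k. X k \<omega> = R + j}"
            using card_mono[OF that, of "{k, k'}"] k by simp
          then have "local_time X \<omega> (R + j) > 1"
            by (auto simp: local_time_def one_enat_def)
          ultimately show ?thesis by (intro exI[of _ "R + j"]) auto
        qed
        then show "\<exists>R\<^sub>0. \<forall>R\<ge>R\<^sub>0. \<exists>S. R \<le> S \<and> real S \<le> real R + f_star \<alpha> R \<epsilon> \<and> local_time X \<omega> S > 1"
          by blast
      qed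
    qed
  qed
qed

end
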